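(* Let $(E,d)$ be a complete metric space, $\mathcal{E}:E\to(-\infty,+\infty]$ and $\kappa\in\mathbb{R}$. Assume: (A1) $(E,d)$ is a geodesic space, and $\mathcal{E}$ is lower semi-continuous with $\mathcal{D}(\mathcal{E})\neq\emptyset$. (A2) There exists an $EVI_\kappa$ gradient flow of $\mathcal{E}$ defined on $D=E$. (A3) For any $\rho,\pi\in E$ with $I(\rho)+\mathcal{E}(\pi)<+\infty$ there exists a geodesic $\zeta^{\rho\to\pi}$ from $\rho$ to $\pi$ such that for any $\theta>0$ there exist $\tau>0$ and a curve (not necessarily a geodesic) $(\zeta^{\rho\to\pi}_\theta(t))_{t\in[0,\tau]}$ in $E$ with $$\limsup_{t\downarrow 0}\frac{d(\zeta^{\rho\to\pi}_\theta(t),\zeta^{\rho\to\pi}(t))}{t}\le\theta\quad(\text{in particular }\zeta^{\rho\to\pi}_\theta(0)=\rho)$$ and $$\liminf_{t\downarrow 0}\frac{\mathcal{E}(\zeta^{\rho\to\pi}_\theta(t))-\mathcal{E}(\rho)}{t}\le|\partial\mathcal{E}|(\rho)\,(d(\rho,\pi)+\theta).$$ Let $\lambda>0$ and let $h^\dagger,h^\ddagger:E\to\mathbb{R}$ be bounded and uniformly continuous. Let $u:E\to\mathbb{R}$ be a viscosity subsolution to $f-\lambda H_\dagger f=h^\dagger$ and let $v:E\to\mathbb{R}$ be a viscosity supersolution to $f-\lambda H_\ddagger f=h^\ddagger$. Then $$\sup_{\pi\in E}\big(u(\pi)-v(\pi)\big)\le\sup_{\pi\in E}\big(h^\dagger(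\pi)-h^\ddagger(\pi)\big).$$
   Context: Domain and slope: $\mathcal{D}(\mathcal{E})=\{\pi\in E:\mathcal{E}(\pi)<+\infty\}$. The local slope is $|\partial\mathcal{E}|(\rho)=\limsup_{\pi\to\rho}\frac{(\mathcal{E}(\rho)-\mathcal{E}(\pi))^+}{d(\rho,\pi)}$ if $\mathcal{E}(\rho)<+\infty$, and $+\infty$ otherwise. The information functional is $I(\pi)=|\partial\mathcal{E}|^2(\pi)$ if $\pi\in\mathcal{D}(\mathcal{E})$ and $+\infty$ otherwise. Geodesics: a geodesic from $\rho$ to $\pi$ is a curve $\zeta:[0,1]\to E$ with $\zeta(0)=\rho$, $\zeta(1)=\pi$ and $d(\zeta(s),\zeta(t))=|t-s|d(\rho,\pi)$ for all $s,t\in[0,1]$. $(E,d)$ is a geodesic space if any two points are joined by a geodesic. EVI gradient flow: a solution of $EVI_\kappa$ is a continuous curve $\gamma:[0,+\infty)\to E$ with $\gamma((0,+\infty))\subseteq\mathcal{D}(\mathcal{E})$ such that for all $\rho\in\mathcal{D}(\mathcal{E})$, $t\in[0,+\infty)$, $$\frac12\frac{d^+}{dt}d^2(\gamma(t),\rho)\le\mathcal{E}(\rho)-\mathcal{E}(\gamma(t))-\frac{\kappa}{2}d^2(\gamma(t),\rho),$$ where $\frac{d^+}{dt}$ is the upper right time derivative. An $EVI_\kappa$ gradient flow of $\mathcal{E}$ on $D\subset\overline{\mathcal{D}(\mathcal{E})}$ is a family of continuous maps $S(t):D\to D$, $t\ge0$, such that for every $\pi\in D$: $S[\pi](0)=\pi$,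 $S[\pi](t+s)=S[S[\pi](t)](s)$ for $s,t\ge 0$, and $t\mapsto S[\pi](t)$ is a solution of $EVI_\kappa$. One writes $\pi(t):=S[\pi](t)$. Tataru distance: with $\hat\kappa=\min(0,\kappa)$, $d_T(\pi,\rho)=\inf_{t\ge0}\{t+e^{\hat\kappa t}d(\pi,\rho(t))\}$ for $\pi,\rho\in E$. Hamiltonians: $H_\dagger$ is the set of all pairs $(f^\dagger,g^\dagger)$ of functions on $E$, indexed by $a,b>0$, $c\in\mathbb{R}$, $\mu,\rho\in E$ with $\mathcal{E}(\rho)<\infty$, of the form $$f^\dagger(\pi)=\tfrac12 a\,d^2(\pi,\rho)+b\,d_T(\pi,\mu)+c,$$ $$g^\dagger(\pi)=a[\mathcal{E}(\rho)-\mathcal{E}(\pi)]-a\tfrac{\kappa}{2}d^2(\pi,\rho)+b+\tfrac12a^2d^2(\pi,\rho)+ab\,d(\pi,\rho)+\tfrac12b^2.$$ $H_\ddagger$ is the set of all pairs $(f^\ddagger,g^\ddagger)$, indexed by $a,b>0$, $c\in\mathbb{R}$, $\pi,\gamma\in E$ with $\mathcal{E}(\gamma)<\infty$, of the form $$f^\ddagger(\mu)=-\tfrac12a\,d^2(\gamma,\mu)-b\,d_T(\mu,\pi)+c,$$ $$g^\ddagger(\mu)=a[\mathcal{E}(\mu)-\mathcal{E}(\gamma)]+a\tfrac{\kappa}{2}d^2(\gamma,\mu)-b+\tfrac12a^2d^2(\gamma,\mu)-ab\,d(\gamma,\mu)-\tfrac12b^2.$$ Viscosity solutions: $u$ is a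 (viscosity) subsolution of $f-\lambda H_\dagger f=h^\dagger$ if $u$ is bounded, upper semi-continuous and for all $(f,g)\in H_\dagger$ there is a sequence $(\pi_n)$ in $E$ with $\lim_n (u(\pi_n)-f(\pi_n))=\sup_\pi (u(\pi)-f(\pi))$ and $\limsup_n (u(\pi_n)-\lambda g(\pi_n)-h^\dagger(\pi_n))\le0$. $v$ is a (viscosity) supersolution of $f-\lambda H_\ddagger f=h^\ddagger$ if $v$ is bounded, lower semi-continuous and for all $(f,g)\in H_\ddagger$ there is a sequence $(\pi_n)$ in $E$ with $\lim_n (v(\pi_n)-f(\pi_n))=\inf_\pi (v(\pi)-f(\pi))$ and $\liminf_n (v(\pi_n)-\lambda g(\pi_n)-h^\ddagger(\pi_n))\ge0$. *)

theory Defs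
  imports "HOL-Analysis.Analysis"
begin

definition lower_semicontinuous :: "('a::topological_space \<Rightarrow> 'b::linorder) \<Rightarrow> bool" where
  "lower_semicontinuous f \<longleftrightarrow> (\<forall>x. \<forall>y < f x. \<forall>\<^sub>F z in nhds x. y < f z)"

definition upper_semicontinuous :: "('a::topological_space \<Rightarrow> 'b::linorder) \<Rightarrow> bool" where
  "upper_semicontinuous f \<longleftrightarrow> (\<forall>x. \<forall>y > f x. \<forall>\<^sub>F z in nhds x. f z < y)"

definition energy_domain :: "('a \<Rightarrow> ereal) \<Rightarrow> 'a set" where
  "energy_domain \<E> = {\<pi>. \<E> \<pi> < \<infinity>}"

text \<open>The outer maximum is only relevant at isolated points, where the upper limit over the
  punctured neighbourhood is \<open>-\<infinity>\<close> in the library; the slope there is \<open>0\<close> by convention.\<close>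

definition local_slope :: "('a::metric_space \<Rightarrow> ereal) \<Rightarrow> 'a \<Rightarrow> ereal" where
  "local_slope \<E> \<rho> =
     (if \<E> \<rho> < \<infinity>
      then max 0 (Limsup (at \<rho>) (\<lambda>\<pi>. max 0 (\<E> \<rho> - \<E> \<pi>) / ereal (dist \<rho> \<pi>)))
      else \<infinity>)"

definition information :: "('a::metric_space \<Rightarrow> ereal) \<Rightarrow> 'a \<Rightarrow> ereal" where
  "information \<E> \<pi> = (if \<pi> \<in> energy_domain \<E> then (local_slope \<E> \<pi>)\<^sup>2 else \<infinity>)"

definition geodesic :: "(real \<Rightarrow> 'a::metric_space) \<Rightarrow> 'a \<Rightarrow> 'a \<Rightarrow> bool" where
  "geodesic \<zeta> \<rho> \<pi> \<longleftrightarrow> \<zeta> 0 = \<rho> \<and> \<zeta> 1 = \<pi> \<and>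
     (\<forall>s\<in>{0..1}. \<forall>t\<in>{0..1}. dist (\<zeta> s) (\<zeta> t) = \<bar>t - s\<bar> * dist \<rho> \<pi>)"

definition geodesic_space :: "'a::metric_space itself \<Rightarrow> bool" where
  "geodesic_space _ \<longleftrightarrow> (\<forall>\<rho> \<pi> :: 'a. \<exists>\<zeta>. geodesic \<zeta> \<rho> \<pi>)"

definition upper_right_deriv :: "(real \<Rightarrow> real) \<Rightarrow> real \<Rightarrow> ereal" where
  "upper_right_deriv f t = Limsup (at_right t) (\<lambda>s. ereal ((f s - f t) / (s - t)))"

definition EVI_solution ::
  "('a::metric_space \<Rightarrow> ereal) \<Rightarrow> real \<Rightarrow> (real \<Rightarrow> 'a) \<Rightarrow> bool" where
  "EVI_solution \<E> \<kappa> \<gamma> \<longleftrightarrow>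
     continuous_on {0..} \<gamma> \<and> \<gamma> ` {0<..} \<subseteq> energy_domain \<E> \<and>
     (\<forall>\<rho>\<in>energy_domain \<E>. \<forall>t\<ge>0.
        ereal (1/2) * upper_right_deriv (\<lambda>s. (dist (\<gamma> s) \<rho>)\<^sup>2) t
          \<le> \<E> \<rho> - \<E> (\<gamma> t) - ereal (\<kappa> / 2 * (dist (\<gamma> t) \<rho>)\<^sup>2))"

text \<open>A flow is a map \<open>S\<close> where \<open>S t \<pi>\<close> is the state at time \<open>t \<ge> 0\<close> when started in \<open>\<pi>\<close>;
  values at negative times are irrelevant.\<close>

definition EVI_gradient_flow ::
  "('a::metric_space \<Rightarrow> ereal) \<Rightarrow> real \<Rightarrow> 'a set \<Rightarrow> (real \<Rightarrow> 'a \<Rightarrow> 'a) \<Rightarrow> bool" where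
  "EVI_gradient_flow \<E> \<kappa> D S \<longleftrightarrow>
     D \<subseteq> closure (energy_domain \<E>) \<and>
     (\<forall>t\<ge>0. S t ` D \<subseteq> D \<and> continuous_on D (S t)) \<and>
     (\<forall>\<pi>\<in>D. S 0 \<pi> = \<pi> \<and>
        (\<forall>s\<ge>0. \<forall>t\<ge>0. S (t + s) \<pi> = S s (S t \<pi>)) \<and>
        EVI_solution \<E> \<kappa> (\<lambda>t. S t \<pi>))"

definition tataru_dist ::
  "real \<Rightarrow> (real \<Rightarrow> 'a::metric_space \<Rightarrow> 'a) \<Rightarrow> 'a \<Rightarrow> 'a \<Rightarrow> real" where
  "tataru_dist \<kappa> S \<pi> \<rho> = (INF t\<in>{0..}. t + exp (min 0 \<kappa> * t) * dist \<pi> (S t \<rho>))"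

text \<open>The curve \<open>z\<close> is an arbitrary map on \<open>{0..\<tau>}\<close>: no continuity beyond what the upper limit
  gives at \<open>0\<close> is imposed.\<close>

definition slope_regular_geodesics :: "('a::metric_space \<Rightarrow> ereal) \<Rightarrow> bool" where
  "slope_regular_geodesics \<E> \<longleftrightarrow>
     (\<forall>\<rho> \<pi>. information \<E> \<rho> + \<E> \<pi> < \<infinity> \<longrightarrow>
        (\<exists>\<zeta>. geodesic \<zeta> \<rho> \<pi> \<and>
           (\<forall>\<theta>>0. \<exists>\<tau>>0. \<exists>z :: real \<Rightarrow> 'a. z 0 = \<rho> \<and>
              Limsup (at 0 within {0..\<tau>}) (\<lambda>t. ereal (dist (z t) (\<zeta> t) / t)) \<le> ereal \<theta> \<and>
              Liminf (at 0 within {0..\<tau>}) (\<lambda>t. (\<E> (z t) - \<E> \<rho>) / ereal t)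
                \<le> local_slope \<E> \<rho> * ereal (dist \<rho> \<pi> + \<theta>))))"

text \<open>The second components take values in the extended reals, since the energy may be infinite
  at the evaluation point.\<close>

definition H_dagger ::
  "('a::metric_space \<Rightarrow> ereal) \<Rightarrow> real \<Rightarrow> (real \<Rightarrow> 'a \<Rightarrow> 'a)
     \<Rightarrow> (('a \<Rightarrow> real) \<times> ('a \<Rightarrow> ereal)) set" where
  "H_dagger \<E> \<kappa> S =
     {(\<lambda>\<pi>. 1/2 * a * (dist \<pi> \<rho>)\<^sup>2 + b * tataru_dist \<kappa> S \<pi> \<mu> + c,
       \<lambda>\<pi>. ereal a * (\<E> \<rho> - \<E> \<pi>)
            + ereal (- a * (\<kappa> / 2) * (dist \<pi> \<rho>)\<^sup>2 + b + 1/2 * a\<^sup>2 * (dist \<pi> \<rho>)\<^sup>2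
                + a * b * dist \<pi> \<rho> + 1/2 * b\<^sup>2))
      | a b c \<mu> \<rho>. a > 0 \<and> b > 0 \<and> \<E> \<rho> < \<infinity>}"

definition H_ddagger ::
  "('a::metric_space \<Rightarrow> ereal) \<Rightarrow> real \<Rightarrow> (real \<Rightarrow> 'a \<Rightarrow> 'a)
     \<Rightarrow> (('a \<Rightarrow> real) \<times> ('a \<Rightarrow> ereal)) set" where
  "H_ddagger \<E> \<kappa> S =
     {(\<lambda>\<mu>. - (1/2) * a * (dist \<gamma> \<mu>)\<^sup>2 - b * tataru_dist \<kappa> S \<mu> \<pi> + c,
       \<lambda>\<mu>. ereal a * (\<E> \<mu> - \<E> \<gamma>)
            + ereal (a * (\<kappa> / 2) * (dist \<gamma> \<mu>)\<^sup>2 - b + 1/2 * a\<^sup>2 * (dist \<gamma> \<mu>)\<^sup>2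
                - a * b * dist \<gamma> \<mu> - 1/2 * b\<^sup>2))
      | a b c \<pi> \<gamma>. a > 0 \<and> b > 0 \<and> \<E> \<gamma> < \<infinity>}"

text \<open>Viscosity sub- and supersolutions of \<open>f - l * H f = h\<close>, for a multivalued operator \<open>H\<close>
  given by its graph.\<close>

definition viscosity_subsolution ::
  "(('a::metric_space \<Rightarrow> real) \<times> ('a \<Rightarrow> ereal)) set \<Rightarrow> real \<Rightarrow> ('a \<Rightarrow> real) \<Rightarrow> ('a \<Rightarrow> real) \<Rightarrow> bool"
  where
  "viscosity_subsolution H l h u \<longleftrightarrow>
     bounded (range u) \<and> upper_semicontinuous u \<and>
     (\<forall>(f, g)\<in>H. \<exists>x :: nat \<Rightarrow> 'a.
        (\<lambda>n. ereal (u (x n) - f (x n))) \<longlonglongrightarrow> (SUP \<pi>. ereal (u \<pi> - f \<pi>)) \<and>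
        limsup (\<lambda>n. ereal (u (x n)) - ereal l * g (x n) - ereal (h (x n))) \<le> 0)"

definition viscosity_supersolution ::
  "(('a::metric_space \<Rightarrow> real) \<times> ('a \<Rightarrow> ereal)) set \<Rightarrow> real \<Rightarrow> ('a \<Rightarrow> real) \<Rightarrow> ('a \<Rightarrow> real) \<Rightarrow> bool"
  where
  "viscosity_supersolution H l h v \<longleftrightarrow>
     bounded (range v) \<and> lower_semicontinuous v \<and>
     (\<forall>(f, g)\<in>H. \<exists>x :: nat \<Rightarrow> 'a.
        (\<lambda>n. ereal (v (x n) - f (x n))) \<longlonglongrightarrow> (INF \<pi>. ereal (v \<pi> - f \<pi>)) \<and>
        liminf (\<lambda>n. ereal (v (x n)) - ereal l * g (x n) - ereal (h (x n))) \<ge> 0)"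

end

theory Submission
  imports Defs
begin

text \<open>
  The proof doubles the variables with two intermediate points. For large \<open>a\<close> and small \<open>\<epsilon>\<close> one
  maximises
  \<open>u \<pi> - v \<mu> - a/2 * (d(\<pi>,\<rho>)\<^sup>2 + d(\<rho>,\<gamma>)\<^sup>2 + d(\<gamma>,\<mu>)\<^sup>2) - \<epsilon> * (T \<rho> + T \<gamma>)\<close>,
  where \<open>T\<close> is the energy corrected by a multiple of \<open>d(\<cdot>,x0)\<^sup>2\<close> to make it bounded below. As the
  space need not be compact, a maximum is only available up to a small perturbation. The perturbation
  is measured by the Tataru distance \<open>d\<^sub>T\<close>, which the test functions admit: it is a complete
  quasi-metric because the flow expands distances at most by \<open>exp (K * t)\<close>
  (\<open>flow_contraction\<close>, \<open>tataru_triangle\<close>, \<open>tataru_Cauchy\<close>), so that Ekeland's principle applies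
  (\<open>ekeland_quasi_metric\<close>). It grows at most at unit speed along a flow line, which makes it harmless
  in all later estimates.

  At such a point four conditions hold. In \<open>\<pi>\<close> and \<open>\<mu>\<close> the definitions of sub- and supersolution
  give the viscosity inequalities, and with them finiteness of the energy
  (\<open>viscosity_inequality_at_maximum\<close>). In \<open>\<rho>\<close> and \<open>\<gamma>\<close> one compares with two kinds of points. Points
  on the flow line bound the slope and give the energy balance (\<open>penalised_minimiser_flow\<close>): the
  slope enters squared, with a favourable sign, because the flow dissipates energy at that rate.
  Points on the approximate geodesics of the slope regularity condition compare adjacent distances
  (\<open>penalised_minimiser_direction\<close>): \<open>a * d(\<pi>,\<rho>)\<close> exceeds \<open>a * d(\<gamma>,\<mu>)\<close> at most by
  \<open>\<epsilon>\<close> times the slopes, up to small terms.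

  When the inequalities are added, the energies telescope through the chain \<open>\<pi>, \<rho>, \<gamma>, \<mu>\<close>, the
  quadratic terms of the two Hamiltonians differ only by the direction estimate, and its slope terms
  are absorbed by the squared slopes (\<open>hamiltonian_sum_estimate\<close>). What remains is
  \<open>h\<^sub>1 \<pi> - h\<^sub>2 \<mu>\<close> and an arbitrarily small error, and \<open>\<pi>\<close> and \<open>\<mu>\<close> are close enough for uniform
  continuity (\<open>comparison_estimate\<close>).
\<close>

section \<open>Upper right derivatives and a Gronwall inequality\<close>

text \<open>The upper right derivative of \<open>f\<close> at \<open>t\<close> is at most \<open>c\<close>. Unlike the upper limit of the quotients, this
  form combines with smooth factors and summands without arithmetic in the extended reals.\<close>

definition dini_le :: "(real \<Rightarrow> real) \<Rightarrow> real \<Rightarrow> real \<Rightarrow> bool" where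
  "dini_le f t c \<longleftrightarrow> (\<forall>c'>c. \<forall>\<^sub>F s in at_right t. f s - f t \<le> c' * (s - t))"

lemma upper_right_deriv_imp_dini_le:
  assumes "upper_right_deriv f t \<le> ereal c"
  shows "dini_le f t c"
  unfolding dini_le_def
proof (intro allI impI)
  fix c' assume "c < c'"
  then have "Limsup (at_right t) (\<lambda>s. ereal ((f s - f t) / (s - t))) < ereal c'"
    using assms unfolding upper_right_deriv_def by (simp add: le_less_trans)
  then have "\<forall>\<^sub>F s in at_right t. ereal ((f s - f t) / (s - t)) < ereal c'"
    by (rule Limsup_lessD)
  with eventually_at_right_less show "\<forall>\<^sub>F s in at_right t. f s - f t \<le> c' * (s - t)"
    by eventually_elim (auto simp: field_simps)
qed

lemma closed_subset_interval_has_last: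
  fixes A :: "real set"
  assumes "closed A" "a \<in> A" "A \<subseteq> {a..b}"
  obtains s where "s \<in> A" "\<And>x. x \<in> A \<Longrightarrow> x \<le> s"
proof -
  have "compact A"
    using assms(1,3) bounded_subset[OF bounded_closed_interval] by (auto simp: compact_eq_bounded_closed)
  then show ?thesis
    using compact_attains_sup[of A] assms(2) that by blast
qed

text \<open>For any \<open>\<epsilon> > 0\<close> consider the last time at which \<open>f\<close> lies below the line of slope \<open>\<epsilon>\<close> through its
  initial value; the bound on the derivative would allow to go on a little beyond it.\<close>

lemma dini_nonincreasing:
  assumes cont: "continuous_on {a..b} f" and "a \<le> b"
    and dini: "\<And>t. t \<in> {a..<b} \<Longrightarrow> dini_le f t 0"
  shows "f b \<le> f a"
proof (rule field_le_epsilon)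
  fix \<epsilon>' :: real assume "\<epsilon>' > 0"
  define \<epsilon> where "\<epsilon> = \<epsilon>' / (b - a + 1)"
  have \<epsilon>: "\<epsilon> > 0" "\<epsilon> * (b - a) \<le> \<epsilon>'"
    using \<open>\<epsilon>' > 0\<close> \<open>a \<le> b\<close> by (auto simp: \<epsilon>_def field_simps)
  define A where "A = {a..b} \<inter> (\<lambda>t. f t - f a - \<epsilon> * (t - a)) -` {..0}"
  have "closed A"
    unfolding A_def by (rule continuous_closed_preimage) (auto intro!: continuous_intros cont)
  moreover have "a \<in> A" "A \<subseteq> {a..b}"
    using \<open>a \<le> b\<close> by (auto simp: A_def)
  ultimately obtain s where s: "s \<in> A" "\<And>x. x \<in> A \<Longrightarrow> x \<le> s"
    by (rule closed_subset_interval_has_last) blast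
  have "s = b"
  proof (rule ccontr)
    assume "s \<noteq> b"
    then have sb: "a \<le> s" "s < b" using s(1) by (auto simp: A_def)
    then have "\<forall>\<^sub>F t in at_right s. f t - f s \<le> \<epsilon> * (t - s)"
      using dini[of s] \<epsilon>(1) by (auto simp: dini_le_def)
    moreover have "\<forall>\<^sub>F t in at_right s. t \<in> {s<..<b}"
      using sb(2) by (rule eventually_at_right_real)
    ultimately have "\<forall>\<^sub>F t in at_right s. t \<in> A \<and> s < t"
    proof eventually_elim
      case (elim t)
      then show ?case using s(1) sb by (auto simp: A_def algebra_simps)
    qed
    then show False
      using s(2) eventually_happens'[OF trivial_limit_at_right_real] by fastforce
  qed
  then show "f b \<le> f a + \<epsilon>'"
    using s(1) \<epsilon>(2) by (auto simp: A_def)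
qed

lemma dini_le_mult_smooth:
  assumes f: "dini_le f t m" and g: "(g has_real_derivative g') (at t)" and pos: "\<And>s. g s > 0"
  shows "dini_le (\<lambda>s. g s * f s) t (g t * m + g' * f t)"
  unfolding dini_le_def
proof (intro allI impI)
  fix C assume C: "g t * m + g' * f t < C"
  define m' where "m' = m + (C - (g t * m + g' * f t)) / (2 * g t)"
  have gt: "g t > 0" by (rule pos)
  have m': "m < m'" using C gt by (auto simp: m'_def)
  have "g t * m' + g' * f t = (C + (g t * m + g' * f t)) / 2"
    using gt by (simp add: m'_def field_simps)
  then have lt: "g t * m' + f t * g' < C" using C by (simp add: field_simps)
  have "((\<lambda>s. (g s - g t) / (s - t)) \<longlongrightarrow> g') (at_right t)"
    by (rule tendsto_within_subset[OF g[unfolded has_field_derivative_iff]]) simp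
  moreover have "(g \<longlongrightarrow> g t) (at_right t)"
    by (rule tendsto_within_subset[OF DERIV_isCont[OF g, unfolded isCont_def]]) simp
  ultimately have "((\<lambda>s. g s * m' + f t * ((g s - g t) / (s - t))) \<longlongrightarrow> g t * m' + f t * g') (at_right t)"
    by (intro tendsto_intros)
  from order_tendstoD(2)[OF this lt]
  have "\<forall>\<^sub>F s in at_right t. g s * m' + f t * ((g s - g t) / (s - t)) < C" .
  moreover have "\<forall>\<^sub>F s in at_right t. f s - f t \<le> m' * (s - t)"
    using f m' by (auto simp: dini_le_def)
  ultimately show "\<forall>\<^sub>F s in at_right t. g s * f s - g t * f t \<le> C * (s - t)"
    using eventually_at_right_less
  proof eventually_elim
    case (elim s)
    have "g s * f s - g t * f t = g s * (f s - f t) + f t * (g s - g t)"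
      by (simp add: algebra_simps)
    also have "\<dots> \<le> g s * (m' * (s - t)) + f t * (g s - g t)"
      using elim(2) pos[of s] by simp
    also have "\<dots> = (g s * m' + f t * ((g s - g t) / (s - t))) * (s - t)"
      using elim(3) by (simp add: field_simps)
    also have "\<dots> \<le> C * (s - t)"
      using elim(1,3) by (intro mult_right_mono) auto
    finally show ?case .
  qed
qed

lemma dini_le_diff_smooth:
  assumes f: "dini_le f t m" and g: "(g has_real_derivative g') (at t)"
  shows "dini_le (\<lambda>s. f s - g s) t (m - g')"
  unfolding dini_le_def
proof (intro allI impI)
  fix C assume C: "m - g' < C"
  define \<delta> where "\<delta> = (C - (m - g')) / 2"
  have \<delta>: "\<delta> > 0" using C by (simp add: \<delta>_def)
  have "((\<lambda>s. (g s - g t) / (s - t)) \<longlongrightarrow> g') (at_right t)"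
    by (rule tendsto_within_subset[OF g[unfolded has_field_derivative_iff]]) simp
  from order_tendstoD(1)[OF this, of "g' - \<delta>"] \<delta>
  have "\<forall>\<^sub>F s in at_right t. g' - \<delta> < (g s - g t) / (s - t)" by simp
  moreover have "\<forall>\<^sub>F s in at_right t. f s - f t \<le> (m + \<delta>) * (s - t)"
    using f \<delta> by (auto simp: dini_le_def)
  ultimately show "\<forall>\<^sub>F s in at_right t. f s - g s - (f t - g t) \<le> C * (s - t)"
    using eventually_at_right_less
  proof eventually_elim
    case (elim s)
    have "(g' - \<delta>) * (s - t) \<le> g s - g t"
      using elim(1,3) by (simp add: field_simps)
    then have "f s - g s - (f t - g t) \<le> (m + \<delta>) * (s - t) - (g' - \<delta>) * (s - t)"
      using elim(2) by linarith
    also have "\<dots> = C * (s - t)" by (simp add: \<delta>_def field_simps)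
    finally show ?case .
  qed
qed

text \<open>This is the integral of \<open>exp (- k * s)\<close> over \<open>{0..t}\<close>. Replacing it by \<open>t\<close> would be correct for one sign of
  the inhomogeneity only, while the energy differences below take both signs.\<close>

definition exp_weight :: "real \<Rightarrow> real \<Rightarrow> real" where
  "exp_weight k t = (if k = 0 then t else (1 - exp (- k * t)) / k)"

lemma exp_weight_0 [simp]: "exp_weight k 0 = 0"
  by (simp add: exp_weight_def)

lemma exp_weight_deriv: "(exp_weight k has_real_derivative exp (- k * t)) (at t)"
proof (cases "k = 0")
  case True
  then show ?thesis by (simp add: exp_weight_def[abs_def])
next
  case False
  then show ?thesis unfolding exp_weight_def[abs_def]
    by (auto intro!: derivative_eq_intros simp: field_simps)
qed

lemma exp_weight_bounds:
  assumes "k \<ge> 0" "t \<ge> 0"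
  shows "exp_weight k t \<le> t" "t * exp (- k * t) \<le> exp_weight k t"
proof -
  have "1 - k * t \<le> exp (- k * t)" "1 + k * t \<le> exp (k * t)"
    using exp_ge_add_one_self[of "- k * t"] exp_ge_add_one_self[of "k * t"] by auto
  then have "1 - exp (- k * t) \<le> k * t" "k * t * exp (- k * t) \<le> 1 - exp (- k * t)"
    using mult_right_mono[of "1 + k * t" "exp (k * t)" "exp (- k * t)"]
    by (auto simp: algebra_simps simp flip: exp_add)
  then show "exp_weight k t \<le> t" "t * exp (- k * t) \<le> exp_weight k t"
    using assms by (auto simp: exp_weight_def field_simps)
qed

lemma exp_weight_pos: "k \<ge> 0 \<Longrightarrow> t > 0 \<Longrightarrow> exp_weight k t > 0"
  using exp_weight_bounds(2)[of k t] by (smt (verit) exp_gt_zero mult_pos_pos)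

text \<open>The derivative bound makes \<open>exp (- k * s) * f s - c * exp_weight k s\<close> nonincreasing.\<close>

lemma dini_gronwall:
  assumes cont: "continuous_on {0..T} f" and "0 \<le> T"
    and dini: "\<And>t. t \<in> {0..<T} \<Longrightarrow> dini_le f t (c + k * f t)"
  shows "exp (- k * T) * f T \<le> f 0 + c * exp_weight k T"
proof -
  have W: "((\<lambda>s. c * exp_weight k s) has_real_derivative c * exp (- k * t)) (at t)" for t
    by (rule DERIV_cmult[OF exp_weight_deriv])
  have X: "((\<lambda>s. exp (- k * s)) has_real_derivative - k * exp (- k * t)) (at t)" for t
    by (auto intro!: derivative_eq_intros)
  have contW: "continuous_on A (exp_weight k)" for A
    by (rule DERIV_continuous_on) (rule has_field_derivative_at_within[OF exp_weight_deriv])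
  have "exp (- k * T) * f T - c * exp_weight k T \<le> exp (- k * 0) * f 0 - c * exp_weight k 0"
  proof (rule dini_nonincreasing[where f = "\<lambda>s. exp (- k * s) * f s - c * exp_weight k s"])
    show "continuous_on {0..T} (\<lambda>s. exp (- k * s) * f s - c * exp_weight k s)"
      by (intro continuous_intros cont contW)
    fix t assume "t \<in> {0..<T}"
    from dini_le_diff_smooth[OF dini_le_mult_smooth[OF dini[OF this] X] W]
    show "dini_le (\<lambda>s. exp (- k * s) * f s - c * exp_weight k s) t 0"
      by (simp add: algebra_simps)
  qed fact
  then show ?thesis by simp
qed

lemma dini_le_mono: "dini_le f t c \<Longrightarrow> c \<le> c' \<Longrightarrow> dini_le f t c'"
  by (auto simp: dini_le_def)

section \<open>Monotonicity of the energy and contraction along the flow\<close>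

lemma lower_semicontinuous_closed_sublevel:
  assumes "lower_semicontinuous E"
  shows "closed {x. E x \<le> m}"
proof -
  have "open {x. m < E x}"
    using assms by (subst open_subopen) (fastforce simp: lower_semicontinuous_def eventually_nhds)
  then show ?thesis
    by (simp add: closed_def Collect_neg_eq[symmetric] not_le)
qed

locale evi_flow =
  fixes E :: "'a::metric_space \<Rightarrow> ereal" and \<kappa> :: real and S :: "real \<Rightarrow> 'a \<Rightarrow> 'a"
  assumes energy_not_minf: "E x \<noteq> -\<infinity>"
    and lsc: "lower_semicontinuous E"
    and flow: "EVI_gradient_flow E \<kappa> UNIV S"
begin

definition dom :: "'a set" where "dom = energy_domain E"

text \<open>Meaningful on \<open>dom\<close> only: where the energy is infinite, \<open>e\<close> is \<open>0\<close>.\<close>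

definition e :: "'a \<Rightarrow> real" where "e x = real_of_ereal (E x)"

text \<open>The rate at which the flow may expand distances.\<close>

definition K :: real where "K = - min 0 \<kappa>"

lemma K_nonneg: "0 \<le> K" and K_ge: "- \<kappa> \<le> K"
  by (auto simp: K_def)

lemma energy_eq: "x \<in> dom \<Longrightarrow> E x = ereal (e x)"
  using energy_not_minf[of x] by (cases "E x") (auto simp: dom_def energy_domain_def e_def)

lemma in_dom_iff: "x \<in> dom \<longleftrightarrow> E x < \<infinity>"
  by (simp add: dom_def energy_domain_def)

lemma in_domI: "E x \<le> ereal c \<Longrightarrow> x \<in> dom"
  by (auto simp: in_dom_iff)

lemma energy_leD: "E x \<le> ereal c \<Longrightarrow> e x \<le> c"
  using energy_eq in_domI by fastforce

lemma flow_0 [simp]: "S 0 x = x"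
  using flow by (auto simp: EVI_gradient_flow_def)

lemma flow_add: "s \<ge> 0 \<Longrightarrow> t \<ge> 0 \<Longrightarrow> S (t + s) x = S s (S t x)"
  using flow by (auto simp: EVI_gradient_flow_def)

lemma flow_continuous_time: "continuous_on {0..} (\<lambda>t. S t x)"
  using flow by (auto simp: EVI_gradient_flow_def EVI_solution_def)

lemma flow_continuous_space: "t \<ge> 0 \<Longrightarrow> continuous_on UNIV (S t)"
  using flow by (auto simp: EVI_gradient_flow_def)

lemma flow_in_dom: "t > 0 \<Longrightarrow> S t x \<in> dom"
  using flow by (fastforce simp: EVI_gradient_flow_def EVI_solution_def dom_def)

lemma dom_dense: "x \<in> closure dom"
  using flow by (auto simp: EVI_gradient_flow_def dom_def)

lemma flow_tendsto_0: "((\<lambda>t. S t x) \<longlongrightarrow> x) (at_right 0)"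
proof -
  have "((\<lambda>t. S t x) \<longlongrightarrow> S 0 x) (at 0 within {0..})"
    using flow_continuous_time[of x] unfolding continuous_on_def by (metis atLeast_iff order_refl)
  then show ?thesis
    by (simp add: at_within_Ici_at_right)
qed

text \<open>The energy enters through a bound \<open>c\<close> in the extended reals, to cover \<open>t = 0\<close> with a starting point of
  infinite energy, where every \<open>c\<close> is admissible.\<close>

lemma flow_dini:
  assumes "r \<in> dom" "t \<ge> 0" and c: "E r - E (S t x) \<le> ereal c"
  shows "dini_le (\<lambda>s. (dist (S s x) r)\<^sup>2) t (2 * c + K * (dist (S t x) r)\<^sup>2)"
proof -
  let ?D = "upper_right_deriv (\<lambda>s. (dist (S s x) r)\<^sup>2) t"
  have "ereal (1/2) * ?D \<le> E r - E (S t x) - ereal (\<kappa> / 2 * (dist (S t x) r)\<^sup>2)"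
    using flow assms(1,2) by (auto simp: EVI_gradient_flow_def EVI_solution_def dom_def)
  also have "\<dots> \<le> ereal c - ereal (\<kappa> / 2 * (dist (S t x) r)\<^sup>2)"
    by (intro ereal_minus_mono c order_refl)
  finally have "?D \<le> ereal (2 * c - \<kappa> * (dist (S t x) r)\<^sup>2)"
    by (cases ?D) (auto simp: field_simps)
  then have "dini_le (\<lambda>s. (dist (S s x) r)\<^sup>2) t (2 * c - \<kappa> * (dist (S t x) r)\<^sup>2)"
    by (rule upper_right_deriv_imp_dini_le)
  then show ?thesis
    by (rule dini_le_mono) (use K_ge mult_right_mono[of "- \<kappa>" K "(dist (S t x) r)\<^sup>2"] in auto)
qed

lemma dist_flow_continuous: "continuous_on {0..T} (\<lambda>s. (dist (S s x) r)\<^sup>2)"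
  by (intro continuous_intros continuous_on_subset[OF flow_continuous_time]) auto

lemma flow_gronwall:
  assumes "r \<in> dom" "T \<ge> 0" and c: "\<And>t. t \<in> {0..<T} \<Longrightarrow> E r - E (S t x) \<le> ereal c"
  shows "exp (- K * T) * (dist (S T x) r)\<^sup>2 \<le> (dist x r)\<^sup>2 + 2 * c * exp_weight K T"
  using dini_gronwall[OF dist_flow_continuous \<open>T \<ge> 0\<close> flow_dini[OF assms(1) _ c]] by auto

text \<open>Otherwise let \<open>s\<close> be the last time at which the energy is at most its initial value.
  Tested against \<open>r = S s x\<close>, the variational inequality on \<open>{s..t}\<close> has no positive energy term,
  so the curve cannot leave \<open>r\<close> and the energy cannot have grown.\<close>

lemma energy_flow_le:
  assumes "t \<ge> 0"
  shows "E (S t x) \<le> E x"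
proof (cases "x \<in> dom")
  case False
  then show ?thesis by (simp add: in_dom_iff)
next
  case True
  define A where "A = {0..t} \<inter> (\<lambda>s. S s x) -` {y. E y \<le> E x}"
  have "closed A"
    unfolding A_def
    by (intro continuous_closed_preimage lower_semicontinuous_closed_sublevel lsc
        continuous_on_subset[OF flow_continuous_time]) auto
  moreover have "0 \<in> A" "A \<subseteq> {0..t}"
    using \<open>t \<ge> 0\<close> by (auto simp: A_def)
  ultimately obtain s where s: "s \<in> A" "\<And>y. y \<in> A \<Longrightarrow> y \<le> s"
    by (rule closed_subset_interval_has_last) blast
  define r where "r = S s x"
  have s0: "0 \<le> s" "s \<le> t" and Er: "E r \<le> E x"
    using s(1) by (auto simp: A_def r_def)
  have r: "r \<in> dom" using Er True by (auto simp: in_dom_iff)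
  have "E r - E (S \<tau> r) \<le> ereal 0" if \<tau>: "\<tau> \<in> {0..<t - s}" for \<tau>
  proof (cases "\<tau> = 0")
    case True
    then show ?thesis using energy_eq[OF r] by simp
  next
    case False
    then have "s + \<tau> \<notin> A" using s(2)[of "s + \<tau>"] \<tau> by auto
    then have "E x < E (S \<tau> r)"
      using \<tau> s0 by (auto simp: A_def r_def flow_add)
    then have "E r \<le> E (S \<tau> r)" using Er by simp
    then show ?thesis using energy_eq[OF r] by (cases "E (S \<tau> r)") auto
  qed
  from flow_gronwall[OF r _ this] s0
  have "S (t - s) r = r" by (auto simp: zero_le_mult_iff mult_le_0_iff)
  then have "S t x = r"
    using flow_add[of "t - s" s x] s0 by (simp add: r_def)
  then show ?thesis using Er by simp
qed

lemma energy_flow_mono: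
  assumes "0 \<le> s" "s \<le> t"
  shows "E (S t x) \<le> E (S s x)"
  using energy_flow_le[of "t - s" "S s x"] flow_add[of "t - s" s x] assms by simp

text \<open>As the energy decreases in time, its value at the final time may stand for all earlier ones.\<close>

lemma integrated_evi:
  assumes r: "r \<in> dom" and "t > 0"
  shows "exp (- K * t) * (dist (S t x) r)\<^sup>2 \<le> (dist x r)\<^sup>2 + 2 * (e r - e (S t x)) * exp_weight K t"
proof (rule flow_gronwall[OF r])
  fix s assume "s \<in> {0..<t}"
  then have "E (S t x) \<le> E (S s x)" by (intro energy_flow_mono) auto
  moreover have "E (S t x) = ereal (e (S t x))" by (intro energy_eq flow_in_dom \<open>t > 0\<close>)
  ultimately show "E r - E (S s x) \<le> ereal (e r - e (S t x))"
    using energy_eq[OF r] by (cases "E (S s x)") auto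
qed (use \<open>t > 0\<close> in auto)

lemma e_flow_mono: "0 < s \<Longrightarrow> s \<le> t \<Longrightarrow> e (S t x) \<le> e (S s x)"
  using energy_flow_mono[of s t x] energy_eq[OF flow_in_dom[of s x]] energy_eq[OF flow_in_dom[of t x]]
  by simp

lemma e_flow_le: "x \<in> dom \<Longrightarrow> 0 \<le> t \<Longrightarrow> e (S t x) \<le> e x"
  using energy_flow_le[of t x] by (intro energy_leD) (simp add: energy_eq)

lemma flow_preserves_dom: "x \<in> dom \<Longrightarrow> 0 \<le> t \<Longrightarrow> S t x \<in> dom"
  using energy_flow_le[of t x] by (intro in_domI) (simp add: energy_eq)

text \<open>Each curve is tested at a point of the other: first the one from \<open>x\<close> at \<open>y\<close>, then the one from \<open>y\<close> at
  \<open>S h x\<close>. The energy of \<open>S h x\<close> cancels except for the factor \<open>1 - exp (- K * h)\<close>, which is of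
  order \<open>h\<close>.\<close>

lemma flow_contraction_step:
  assumes x: "x \<in> dom" and y: "y \<in> dom" and h: "h > 0"
    and M: "\<bar>e (S h x) - e (S h y)\<bar> \<le> M"
  shows "exp (- 2 * K * h) * (dist (S h x) (S h y))\<^sup>2
     \<le> (dist x y)\<^sup>2 + 2 * exp_weight K h * (e y - e (S h y) + K * h * M)"
proof -
  define w where "w = exp_weight K h"
  define q where "q = exp (- K * h)"
  have w: "w > 0" using exp_weight_pos[OF K_nonneg h] by (simp add: w_def)
  have q: "0 < q" "1 - q \<le> K * h" "0 \<le> 1 - q"
    using exp_ge_add_one_self[of "- K * h"] K_nonneg h by (auto simp: q_def)
  have 1: "q * (dist (S h x) y)\<^sup>2 \<le> (dist x y)\<^sup>2 + 2 * (e y - e (S h x)) * w"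
    using integrated_evi[OF y h, of x] by (simp add: q_def w_def)
  have 2: "q * (dist (S h x) (S h y))\<^sup>2 \<le> (dist (S h x) y)\<^sup>2 + 2 * (e (S h x) - e (S h y)) * w"
    using integrated_evi[OF flow_in_dom[OF h] h, of y x] by (simp add: q_def w_def dist_commute)
  have "exp (- 2 * K * h) = q * q" by (simp add: q_def flip: exp_add)
  then have "exp (- 2 * K * h) * (dist (S h x) (S h y))\<^sup>2 = q * (q * (dist (S h x) (S h y))\<^sup>2)"
    by simp
  also have "\<dots> \<le> q * ((dist (S h x) y)\<^sup>2 + 2 * (e (S h x) - e (S h y)) * w)"
    using 2 q by simp
  also have "\<dots> \<le> (dist x y)\<^sup>2 + 2 * (e y - e (S h x)) * w + q * (2 * (e (S h x) - e (S h y)) * w)"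
    using 1 by (simp add: distrib_left)
  also have "\<dots> = (dist x y)\<^sup>2 + 2 * w * (e y - e (S h y) + (1 - q) * (e (S h y) - e (S h x)))"
    by (simp add: algebra_simps)
  also have "\<dots> \<le> (dist x y)\<^sup>2 + 2 * w * (e y - e (S h y) + K * h * M)"
  proof -
    have "(1 - q) * (e (S h y) - e (S h x)) \<le> (1 - q) * M" using M q by (intro mult_left_mono) auto
    also have "\<dots> \<le> K * h * M" using M q by (intro mult_right_mono) auto
    finally show ?thesis using w by simp
  qed
  finally show ?thesis by (simp add: w_def)
qed

text \<open>With \<open>T\<close> cut into \<open>n\<close> steps, the energy terms of the single steps telescope up to an error of
  order \<open>1 / n\<close>.\<close>

lemma flow_contraction_dom:
  assumes x: "x \<in> dom" and y: "y \<in> dom" and T: "T > 0"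
  shows "dist (S T x) (S T y) \<le> exp (K * T) * dist x y"
proof -
  define M where "M = \<bar>e x\<bar> + \<bar>e y\<bar> + \<bar>e (S T x)\<bar> + \<bar>e (S T y)\<bar>"
  have M: "\<bar>e (S t x) - e (S t y)\<bar> \<le> M" if "0 \<le> t" "t \<le> T" for t
  proof (cases "t = 0")
    case True
    then show ?thesis by (auto simp: M_def)
  next
    case False
    then show ?thesis
      using e_flow_le[OF x, of t] e_flow_le[OF y, of t] e_flow_mono[of t T x] e_flow_mono[of t T y] that
      by (auto simp: M_def abs_if)
  qed
  have bound: "exp (- 2 * K * T) * (dist (S T x) (S T y))\<^sup>2
      \<le> (dist x y)\<^sup>2 + 2 * (T / n) * (e y - e (S T y) + K * T * M)" if n: "n > 0" for n :: nat
  proof -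
    define h where "h = T / n"
    have h: "h > 0" using T n by (simp add: h_def)
    have "exp (- 2 * K * (real j * h)) * (dist (S (real j * h) x) (S (real j * h) y))\<^sup>2
      \<le> (dist x y)\<^sup>2 + 2 * exp_weight K h * (e y - e (S (real j * h) y) + real j * (K * h * M))"
      if "j \<le> n" for j
      using that
    proof (induction j)
      case 0
      then show ?case by simp
    next
      case (Suc j)
      define t where "t = real j * h"
      have t: "0 \<le> t" "t + h \<le> T"
      proof -
        have "real (Suc j) * h \<le> real n * h"
          using Suc.prems h by (intro mult_right_mono) auto
        also have "\<dots> = T" using n by (simp add: h_def)
        finally show "t + h \<le> T" by (simp add: t_def algebra_simps)
      qed (use h in \<open>simp add: t_def\<close>)
      have tS: "real (Suc j) * h = t + h" by (simp add: t_def algebra_simps)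
      let ?d = "dist (S t x) (S t y)" and ?d' = "dist (S (t + h) x) (S (t + h) y)"
      have step: "exp (- 2 * K * h) * ?d'\<^sup>2
        \<le> ?d\<^sup>2 + 2 * exp_weight K h * (e (S t y) - e (S (t + h) y) + K * h * M)"
        using flow_contraction_step[OF flow_preserves_dom[OF x t(1)] flow_preserves_dom[OF y t(1)] h, of M]
          M[of "t + h"] t h by (simp add: flow_add)
      have nonneg: "0 \<le> 2 * exp_weight K h * (e (S t y) - e (S (t + h) y) + K * h * M)"
      proof -
        have "e (S (t + h) y) \<le> e (S t y)"
          using e_flow_le[OF flow_preserves_dom[OF y t(1)], of h] h t by (simp add: flow_add)
        moreover have "0 \<le> K * h * M" using K_nonneg h by (simp add: M_def)
        ultimately show ?thesis using exp_weight_pos[OF K_nonneg h] by simp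
      qed
      have "exp (- 2 * K * (t + h)) * ?d'\<^sup>2 = exp (- 2 * K * t) * (exp (- 2 * K * h) * ?d'\<^sup>2)"
        by (simp add: algebra_simps flip: exp_add)
      also have "\<dots> \<le> exp (- 2 * K * t) * (?d\<^sup>2 + 2 * exp_weight K h * (e (S t y) - e (S (t + h) y) + K * h * M))"
        using step by simp
      also have "\<dots> \<le> exp (- 2 * K * t) * ?d\<^sup>2 + 1 * (2 * exp_weight K h * (e (S t y) - e (S (t + h) y) + K * h * M))"
        unfolding distrib_left[of _ "?d\<^sup>2"]
        by (intro add_left_mono mult_right_mono nonneg) (use K_nonneg t in simp)
      also have "exp (- 2 * K * t) * ?d\<^sup>2 \<le> (dist x y)\<^sup>2 + 2 * exp_weight K h * (e y - e (S t y) + real j * (K * h * M))"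
        using Suc by (simp add: t_def)
      finally show ?case unfolding tS by (simp add: algebra_simps)
    qed
    from this[of n] n
    have "exp (- 2 * K * T) * (dist (S T x) (S T y))\<^sup>2
      \<le> (dist x y)\<^sup>2 + 2 * exp_weight K h * (e y - e (S T y) + K * T * M)"
      by (simp add: h_def)
    also have "\<dots> \<le> (dist x y)\<^sup>2 + 2 * h * (e y - e (S T y) + K * T * M)"
      using exp_weight_bounds(1)[OF K_nonneg, of h] h K_nonneg T e_flow_le[OF y, of T]
      by (intro add_left_mono mult_right_mono add_nonneg_nonneg) (auto simp: M_def)
    finally show ?thesis by (simp add: h_def)
  qed
  have "(\<lambda>n. (dist x y)\<^sup>2 + 2 * (T / real n) * (e y - e (S T y) + K * T * M)) \<longlonglongrightarrow> (dist x y)\<^sup>2 + 2 * 0 * (e y - e (S T y) + K * T * M)"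
    by (intro tendsto_intros lim_const_over_n)
  then have "exp (- 2 * K * T) * (dist (S T x) (S T y))\<^sup>2 \<le> (dist x y)\<^sup>2 + 2 * 0 * (e y - e (S T y) + K * T * M)"
    by (rule Lim_bounded2[where N=1]) (use bound in auto)
  then have "exp (- 2 * K * T) * (dist (S T x) (S T y))\<^sup>2 \<le> (dist x y)\<^sup>2" by simp
  then have "(exp (K * T))\<^sup>2 * (exp (- 2 * K * T) * (dist (S T x) (S T y))\<^sup>2) \<le> (exp (K * T))\<^sup>2 * (dist x y)\<^sup>2"
    by (intro mult_left_mono) auto
  moreover have "(exp (K * T))\<^sup>2 * exp (- 2 * K * T) = 1"
    by (simp add: power2_eq_square flip: exp_add)
  ultimately have "(dist (S T x) (S T y))\<^sup>2 \<le> (exp (K * T) * dist x y)\<^sup>2"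
    unfolding mult.assoc[symmetric] power_mult_distrib by (simp only: mult_1)
  then show ?thesis
    by (rule power2_le_imp_le) simp
qed

lemma flow_contraction:
  assumes T: "T \<ge> 0"
  shows "dist (S T x) (S T y) \<le> exp (K * T) * dist x y"
proof (cases "T = 0")
  case False
  then have T: "T > 0" using T by simp
  have lim: "((\<lambda>\<delta>. S T (S \<delta> x)) \<longlongrightarrow> S T x) (at_right 0)" for x
    using T by (intro continuous_on_tendsto_compose[OF flow_continuous_space flow_tendsto_0]) auto
  show ?thesis
  proof (rule tendsto_le)
    show "((\<lambda>\<delta>. dist (S T (S \<delta> x)) (S T (S \<delta> y))) \<longlongrightarrow> dist (S T x) (S T y)) (at_right 0)"
      by (intro tendsto_intros lim)
    show "((\<lambda>\<delta>. exp (K * T) * dist (S \<delta> x) (S \<delta> y)) \<longlongrightarrow> exp (K * T) * dist x y) (at_right 0)"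
      by (intro tendsto_intros flow_tendsto_0)
    show "\<forall>\<^sub>F \<delta> in at_right 0. dist (S T (S \<delta> x)) (S T (S \<delta> y)) \<le> exp (K * T) * dist (S \<delta> x) (S \<delta> y)"
      using eventually_at_right_less[of "0::real"]
      by eventually_elim (intro flow_contraction_dom flow_in_dom T)
  qed simp
qed simp

section \<open>The Tataru distance as a quasi-metric\<close>

abbreviation dT :: "'a \<Rightarrow> 'a \<Rightarrow> real" where "dT \<equiv> tataru_dist \<kappa> S"

lemma tataru_bdd_below: "bdd_below ((\<lambda>t. t + exp (min 0 \<kappa> * t) * dist x (S t y)) ` {0..})"
  by (rule bdd_belowI[of _ 0]) auto

lemma tataru_le: "t \<ge> 0 \<Longrightarrow> dT x y \<le> t + exp (- K * t) * dist x (S t y)"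
  unfolding tataru_dist_def K_def minus_minus by (intro cINF_lower tataru_bdd_below) auto

lemma tataru_nonneg: "0 \<le> dT x y"
  unfolding tataru_dist_def by (intro cINF_greatest) auto

lemma tataru_lessE:
  assumes "dT x y < c"
  obtains t where "t \<ge> 0" "t + exp (- K * t) * dist x (S t y) < c"
  using assms cINF_less_iff[OF _ tataru_bdd_below, of x y c] unfolding tataru_dist_def K_def by auto

lemma tataru_le_dist: "dT x y \<le> dist x y"
  using tataru_le[of 0 x y] by simp

lemma tataru_self [simp]: "dT x x = 0"
  using tataru_le_dist[of x x] tataru_nonneg[of x x] by simp

lemma tataru_flow_le: "t \<ge> 0 \<Longrightarrow> dT (S t x) x \<le> t"
  using tataru_le[of t "S t x" x] by simp

text \<open>By the semigroup property the time parameters of two steps add up; the weight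
  \<open>exp (- K * t)\<close> absorbs the expansion rate \<open>exp (K * t)\<close> of the flow.\<close>

lemma tataru_triangle: "dT x z \<le> dT x y + dT y z"
proof (rule field_le_epsilon)
  fix \<epsilon> :: real assume "\<epsilon> > 0"
  obtain t where t: "t \<ge> 0" "t + exp (- K * t) * dist x (S t y) < dT x y + \<epsilon> / 2"
    using tataru_lessE[of x y "dT x y + \<epsilon> / 2"] \<open>\<epsilon> > 0\<close> by auto
  obtain s where s: "s \<ge> 0" "s + exp (- K * s) * dist y (S s z) < dT y z + \<epsilon> / 2"
    using tataru_lessE[of y z "dT y z + \<epsilon> / 2"] \<open>\<epsilon> > 0\<close> by auto
  have "dist x (S (s + t) z) \<le> dist x (S t y) + dist (S t y) (S t (S s z))"
    using dist_triangle s t by (simp add: flow_add)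
  also have "\<dots> \<le> dist x (S t y) + exp (K * t) * dist y (S s z)"
    using flow_contraction[OF t(1)] by simp
  finally have "exp (- K * (s + t)) * dist x (S (s + t) z)
      \<le> exp (- K * (s + t)) * (dist x (S t y) + exp (K * t) * dist y (S s z))"
    by simp
  also have "\<dots> = exp (- K * s) * (exp (- K * t) * dist x (S t y)) + exp (- K * s) * dist y (S s z)"
    by (simp add: distrib_left algebra_simps flip: exp_add mult.assoc)
  also have "\<dots> \<le> 1 * (exp (- K * t) * dist x (S t y)) + exp (- K * s) * dist y (S s z)"
    by (intro add_right_mono mult_right_mono) (use K_nonneg s in auto)
  finally have "dT x z \<le> s + t + (exp (- K * t) * dist x (S t y) + exp (- K * s) * dist y (S s z))"
    using tataru_le[of "s + t" x z] s t by simp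
  also have "\<dots> \<le> dT x y + dT y z + \<epsilon>" using s t by simp
  finally show "dT x z \<le> dT x y + dT y z + \<epsilon>" .
qed

lemma tataru_lipschitz: "\<bar>dT x z - dT y z\<bar> \<le> dist x y"
  using tataru_triangle[of x z y] tataru_triangle[of y z x] tataru_le_dist[of x y] tataru_le_dist[of y x]
  by (auto simp: dist_commute)

lemma tataru_tendsto:
  assumes "(x \<longlongrightarrow> y) F"
  shows "((\<lambda>n. dT (x n) z) \<longlongrightarrow> dT y z) F"
proof (rule tendsto_dist_iff[THEN iffD2])
  have "((\<lambda>n. dist (x n) y) \<longlongrightarrow> 0) F"
    using assms tendsto_dist_iff by blast
  then show "((\<lambda>n. dist (dT (x n) z) (dT y z)) \<longlongrightarrow> 0) F"
    by (rule Lim_null_comparison[rotated]) (auto simp: dist_real_def tataru_lipschitz)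
qed

text \<open>By continuity of the flow line at time \<open>0\<close>; the threshold depends on the point \<open>y\<close>.\<close>

lemma tataru_controls_dist:
  assumes "\<epsilon> > 0"
  shows "\<exists>\<delta>>0. \<forall>x. dT x y < \<delta> \<longrightarrow> dist x y < \<epsilon>"
proof -
  have "\<forall>\<^sub>F t in at_right 0. dist (S t y) y < \<epsilon> / 2"
    using flow_tendsto_0[of y] assms by (intro tendstoD) auto
  then obtain \<delta> where \<delta>: "\<delta> > 0" "\<And>t. 0 < t \<Longrightarrow> t < \<delta> \<Longrightarrow> dist (S t y) y < \<epsilon> / 2"
    by (auto simp: eventually_at_right_field)
  define \<delta>' where "\<delta>' = min \<delta> (exp (- K * \<delta>) * (\<epsilon> / 2))"
  have "dist x y < \<epsilon>" if x: "dT x y < \<delta>'" for x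
  proof -
    obtain t where t: "t \<ge> 0" "t + exp (- K * t) * dist x (S t y) < \<delta>'"
      using x by (rule tataru_lessE)
    then have td: "t < \<delta>" and "exp (- K * t) * dist x (S t y) < exp (- K * \<delta>) * (\<epsilon> / 2)"
      by (auto simp: \<delta>'_def intro: le_less_trans[rotated])
    moreover have "exp (- K * \<delta>) \<le> exp (- K * t)"
      using K_nonneg td by (simp add: mult_left_mono)
    ultimately have "exp (- K * t) * dist x (S t y) < exp (- K * t) * (\<epsilon> / 2)"
      using assms mult_right_mono[of "exp (- K * \<delta>)" "exp (- K * t)" "\<epsilon> / 2"] by linarith
    then have "dist x (S t y) < \<epsilon> / 2" by simp
    moreover have "dist (S t y) y < \<epsilon> / 2"
      using \<delta>(2)[of t] td t(1) assms by (cases "t = 0") auto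
    ultimately show ?thesis
      using dist_triangle[of x y "S t y"] by linarith
  qed
  moreover have "\<delta>' > 0" using \<delta>(1) assms by (simp add: \<delta>'_def)
  ultimately show ?thesis by blast
qed

lemma tataru_tendsto_0_imp_tendsto:
  assumes "((\<lambda>n. dT (x n) y) \<longlongrightarrow> 0) F"
  shows "(x \<longlongrightarrow> y) F"
proof (rule tendstoI)
  fix \<epsilon> :: real assume "\<epsilon> > 0"
  then obtain \<delta> where \<delta>: "\<delta> > 0" "\<And>x. dT x y < \<delta> \<Longrightarrow> dist x y < \<epsilon>"
    using tataru_controls_dist by blast
  show "\<forall>\<^sub>F n in F. dist (x n) y < \<epsilon>"
    using order_tendstoD(2)[OF assms \<delta>(1)] by eventually_elim (rule \<delta>)
qed

lemma tataru_separates: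
  assumes "(\<lambda>n. dT x (y n)) \<longlonglongrightarrow> 0" "y \<longlonglongrightarrow> z"
  shows "x = z"
proof -
  have "(\<lambda>n. dT x (y n) + dist (y n) z) \<longlonglongrightarrow> 0 + 0"
    using assms(2) tendsto_dist_iff by (intro tendsto_add assms(1)) blast
  moreover have "dT x z \<le> dT x (y n) + dist (y n) z" for n
    using tataru_triangle[of x z "y n"] tataru_le_dist[of "y n" z] by simp
  ultimately have "dT x z \<le> 0 + 0"
    using LIMSEQ_le_const by blast
  then have "dT x z = 0" using tataru_nonneg[of x z] by simp
  then show ?thesis
    using tataru_tendsto_0_imp_tendsto[of "\<lambda>_. x" z sequentially] by (simp add: LIMSEQ_const_iff)
qed

text \<open>A point close to \<open>x\<close> in the Tataru distance is close to the flow line through \<open>x\<close>, not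
  uniformly close to \<open>x\<close>. Along a sequence with summable steps, the tail therefore follows the flow
  line issued from one fixed element \<open>x m\<close>, along times that converge.\<close>

lemma tataru_Cauchy:
  assumes step: "\<And>n. dT (x (Suc n)) (x n) \<le> (1/2) ^ n"
  shows "Cauchy x"
proof -
  define r where "r = (\<lambda>n. (1/2::real) ^ n)"
  have step': "dT (x (Suc n)) (x n) \<le> r n" for n using step by (simp add: r_def)
  have r: "r n > 0" "r n \<le> 1" for n by (auto simp: r_def power_le_one)
  have r_sum: "(\<Sum>k\<in>{m..<n}. 2 * r k) \<le> 4 * r m" for m n
  proof (cases "m \<le> n")
    case True
    then have "(\<Sum>k\<in>{m..<n}. 2 * r k) = 4 * r m - 4 * r n"
      by (induction rule: dec_induct) (auto simp: r_def)
    then show ?thesis using r(1)[of n] by simp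
  qed (use r(1)[of m] in simp)
  have "\<exists>t\<ge>0. t + exp (- K * t) * dist (x (Suc n)) (S t (x n)) < 2 * r n" for n
  proof -
    have "dT (x (Suc n)) (x n) < 2 * r n" using step'[of n] r(1)[of n] by linarith
    from tataru_lessE[OF this] show ?thesis by blast
  qed
  then obtain t where t: "\<And>n. t n \<ge> 0"
      "\<And>n. t n + exp (- K * t n) * dist (x (Suc n)) (S (t n) (x n)) < 2 * r n"
    by metis
  have t_less: "t n < 2 * r n" for n
    using t(2)[of n] by (smt (verit) exp_gt_zero mult_nonneg_nonneg zero_le_dist)
  have jump: "dist (x (Suc n)) (S (t n) (x n)) \<le> exp (2 * K) * (2 * r n)" for n
  proof -
    have "exp (- K * t n) * dist (x (Suc n)) (S (t n) (x n)) \<le> 2 * r n"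
      using t[of n] by linarith
    then have "exp (K * t n) * (exp (- K * t n) * dist (x (Suc n)) (S (t n) (x n))) \<le> exp (K * t n) * (2 * r n)"
      by (intro mult_left_mono) auto
    then have "dist (x (Suc n)) (S (t n) (x n)) \<le> exp (K * t n) * (2 * r n)"
      by (simp flip: exp_add mult.assoc)
    also have "K * t n \<le> 2 * K"
      using t_less[of n] r(2)[of n] K_nonneg mult_left_mono[of "t n" 2 K] by (simp add: mult.commute)
    finally show ?thesis
      using r(1)[of n] by (smt (verit) exp_le_cancel_iff mult_right_mono)
  qed
  define T where "T = (\<lambda>m n. \<Sum>k\<in>{m..<n}. t k)"
  have T_nonneg: "0 \<le> T m n" for m n
    by (auto simp: T_def intro: sum_nonneg t)
  have T_le: "T m n \<le> 4" for m n
  proof -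
    have "T m n \<le> (\<Sum>k\<in>{m..<n}. 2 * r k)"
      unfolding T_def by (intro sum_mono less_imp_le t_less)
    also have "\<dots> \<le> 4" using r_sum[of m n] r(2)[of m] by simp
    finally show ?thesis .
  qed
  have follow: "dist (x n) (S (T m n) (x m)) \<le> exp (K * T m n) * (\<Sum>k\<in>{m..<n}. exp (2 * K) * (2 * r k))"
    if "m \<le> n" for m n
    using that
  proof (induction rule: dec_induct)
    case base
    then show ?case by (simp add: T_def)
  next
    case (step n)
    let ?s = "\<lambda>n. \<Sum>k\<in>{m..<n}. exp (2 * K) * (2 * r k)"
    have TS: "T m (Suc n) = T m n + t n" using step by (simp add: T_def)
    have "dist (x (Suc n)) (S (T m (Suc n)) (x m))
        \<le> dist (x (Suc n)) (S (t n) (x n)) + dist (S (t n) (x n)) (S (t n) (S (T m n) (x m)))"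
      unfolding TS using dist_triangle by (simp add: flow_add T_nonneg t)
    also have "\<dots> \<le> exp (2 * K) * (2 * r n) + exp (K * t n) * dist (x n) (S (T m n) (x m))"
      by (intro add_mono jump flow_contraction t)
    also have "\<dots> \<le> exp (2 * K) * (2 * r n) + exp (K * t n) * (exp (K * T m n) * ?s n)"
      using step by simp
    also have "exp (2 * K) * (2 * r n) = 1 * (exp (2 * K) * (2 * r n))" by simp
    also have "\<dots> \<le> exp (K * T m (Suc n)) * (exp (2 * K) * (2 * r n))"
      using K_nonneg T_nonneg[of m "Suc n"] r(1)[of n] by (intro mult_right_mono) auto
    also have "exp (K * t n) * (exp (K * T m n) * ?s n) = exp (K * T m (Suc n)) * ?s n"
      by (simp add: TS algebra_simps exp_add)
    also have "exp (K * T m (Suc n)) * (exp (2 * K) * (2 * r n)) + \<dots> = exp (K * T m (Suc n)) * ?s (Suc n)"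
      using step by (simp add: algebra_simps)
    finally show ?case by simp
  qed
  have follow': "dist (x n) (S (T m n) (x m)) \<le> exp (6 * K) * (4 * r m)" if "m \<le> n" for m n
  proof -
    have "dist (x n) (S (T m n) (x m)) \<le> exp (K * T m n) * (exp (2 * K) * (\<Sum>k\<in>{m..<n}. 2 * r k))"
      using follow[OF that] by (simp add: sum_distrib_left)
    also have "\<dots> \<le> exp (4 * K) * (exp (2 * K) * (4 * r m))"
    proof (intro mult_mono r_sum)
      show "exp (K * T m n) \<le> exp (4 * K)"
        using mult_left_mono[OF T_le[of m n] K_nonneg] by (simp add: mult.commute)
    qed (use r(1) in \<open>auto intro!: mult_nonneg_nonneg sum_nonneg less_imp_le[OF r(1)]\<close>)
    also have "\<dots> = exp (6 * K) * (4 * r m)"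
      by (simp add: algebra_simps flip: exp_add mult.assoc)
    finally show ?thesis .
  qed
  show ?thesis
  proof (rule metric_CauchyI)
    fix \<epsilon> :: real assume "\<epsilon> > 0"
    have lim: "(\<lambda>m. exp (6 * K) * (4 * r m)) \<longlonglongrightarrow> exp (6 * K) * (4 * 0)"
      unfolding r_def by (intro tendsto_intros LIMSEQ_realpow_zero) auto
    have "\<forall>\<^sub>F m in sequentially. exp (6 * K) * (4 * r m) < \<epsilon> / 4"
      using \<open>\<epsilon> > 0\<close> by (intro order_tendstoD(2)[OF lim]) simp
    then obtain m where m: "exp (6 * K) * (4 * r m) < \<epsilon> / 4"
      by (auto simp: eventually_sequentially)
    have "incseq (T m)"
      unfolding T_def by (intro incseq_SucI sum_mono2) (auto intro: t)
    moreover have "\<forall>n. T m n \<le> 4" using T_le by blast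
    ultimately obtain L where L: "T m \<longlonglongrightarrow> L"
      by (rule incseq_convergent) blast
    have "L \<ge> 0" using L T_nonneg by (intro LIMSEQ_le_const[OF L]) auto
    have "(\<lambda>n. S (T m n) (x m)) \<longlonglongrightarrow> S L (x m)"
      using T_nonneg \<open>L \<ge> 0\<close> by (intro continuous_on_tendsto_compose[OF flow_continuous_time L]) auto
    then have "Cauchy (\<lambda>n. S (T m n) (x m))" by (rule LIMSEQ_imp_Cauchy)
    then obtain N where N: "\<And>i j. N \<le> i \<Longrightarrow> N \<le> j \<Longrightarrow> dist (S (T m i) (x m)) (S (T m j) (x m)) < \<epsilon> / 2"
      using \<open>\<epsilon> > 0\<close> metric_CauchyD[of _ "\<epsilon> / 2"] by (metis half_gt_zero)
    have "dist (x i) (x j) < \<epsilon>" if "max m N \<le> i" "max m N \<le> j" for i j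
    proof -
      have "dist (x i) (x j) \<le> dist (x i) (S (T m i) (x m)) + dist (S (T m i) (x m)) (x j)"
        by (rule dist_triangle)
      also have "dist (S (T m i) (x m)) (x j) \<le> dist (S (T m i) (x m)) (S (T m j) (x m)) + dist (x j) (S (T m j) (x m))"
        by (rule dist_triangle2)
      finally show ?thesis
        using N[of i j] follow'[of m i] follow'[of m j] m that by simp
    qed
    then show "\<exists>M. \<forall>i\<ge>M. \<forall>j\<ge>M. dist (x i) (x j) < \<epsilon>" by blast
  qed
qed

end

section \<open>Ekeland's variational principle for a quasi-metric\<close>

text \<open>The relation \<open>\<phi> y + b * q x y \<le> \<phi> x\<close> between \<open>x\<close> and \<open>y\<close> is transitive by the triangle
  inequality. Each element of the sequence nearly maximises \<open>\<phi>\<close> among the points related to its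
  predecessor, so the steps become summable, and any point related to the limit is at quasi-distance
  zero from it.\<close>

lemma ekeland_quasi_metric:
  fixes q :: "'x::metric_space \<Rightarrow> 'x \<Rightarrow> real" and \<phi> :: "'x \<Rightarrow> real"
  assumes nonneg: "\<And>x y. 0 \<le> q x y" and self: "\<And>x. q x x = 0"
    and triangle: "\<And>x y z. q x z \<le> q x y + q y z"
    and cont: "\<And>(x :: nat \<Rightarrow> 'x) y z. x \<longlonglongrightarrow> y \<Longrightarrow> (\<lambda>n. q (x n) z) \<longlonglongrightarrow> q y z"
    and separates: "\<And>(y :: nat \<Rightarrow> 'x) x z. (\<lambda>n. q x (y n)) \<longlonglongrightarrow> 0 \<Longrightarrow> y \<longlonglongrightarrow> z \<Longrightarrow> x = z"
    and complete: "\<And>x :: nat \<Rightarrow> 'x. (\<And>n. q (x (Suc n)) (x n) \<le> (1/2) ^ n) \<Longrightarrow> convergent x"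
    and usc: "\<And>(x :: nat \<Rightarrow> 'x) y c. (\<And>n. x n \<in> D) \<Longrightarrow> x \<longlonglongrightarrow> y \<Longrightarrow>
      (\<forall>\<^sub>F n in sequentially. c \<le> \<phi> (x n)) \<Longrightarrow> y \<in> D \<and> c \<le> \<phi> y"
    and bdd: "\<And>x. x \<in> D \<Longrightarrow> \<phi> x \<le> B" and b: "b > 0" and x0: "x0 \<in> D"
  obtains z where "z \<in> D" "\<phi> x0 \<le> \<phi> z" "\<And>x. x \<in> D \<Longrightarrow> \<phi> x - b * q x z \<le> \<phi> z"
proof -
  define A where "A = (\<lambda>y. {x \<in> D. \<phi> y + b * q x y \<le> \<phi> x})"
  have A_self: "y \<in> A y" if "y \<in> D" for y using that by (simp add: A_def self)
  have A_trans: "A x \<subseteq> A y" if "x \<in> A y" for x y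
  proof
    fix z assume z: "z \<in> A x"
    have "b * q z y \<le> b * (q z x + q x y)" using triangle[of z y x] b by simp
    then show "z \<in> A y" using z that by (simp add: A_def algebra_simps)
  qed
  have A_ge: "\<phi> y \<le> \<phi> x" if "x \<in> A y" for x y
    using that nonneg[of x y] b by (auto simp: A_def intro: order_trans[rotated])
  have "\<exists>x. x \<in> A y \<and> (\<forall>z\<in>A y. \<phi> z \<le> \<phi> x + b * (1/2) ^ n)" if y: "y \<in> D" for y and n :: nat
  proof -
    have bA: "bdd_above (\<phi> ` A y)" using bdd by (auto simp: A_def bdd_above_def)
    have ne: "\<phi> ` A y \<noteq> {}" using A_self[OF y] by auto
    have "Sup (\<phi> ` A y) - b * (1/2) ^ n < Sup (\<phi> ` A y)" using b by simp
    then obtain x where "x \<in> A y" "Sup (\<phi> ` A y) - b * (1/2) ^ n < \<phi> x"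
      using less_cSup_iff[OF ne bA] by auto
    moreover have "\<phi> z \<le> Sup (\<phi> ` A y)" if "z \<in> A y" for z
      using that bA by (intro cSup_upper) auto
    ultimately show ?thesis by (intro exI[of _ x]) force
  qed
  then have "\<forall>n y. \<exists>x. y \<in> D \<longrightarrow> x \<in> A y \<and> (\<forall>z\<in>A y. \<phi> z \<le> \<phi> x + b * (1/2) ^ n)"
    by blast
  then obtain nxt :: "nat \<Rightarrow> 'x \<Rightarrow> 'x" where "\<And>n y. y \<in> D \<longrightarrow> nxt n y \<in> A y \<and> (\<forall>z\<in>A y. \<phi> z \<le> \<phi> (nxt n y) + b * (1/2) ^ n)"
    unfolding choice_iff by blast
  then have nxt: "\<And>n y. y \<in> D \<Longrightarrow> nxt n y \<in> A y"
      "\<And>n y z. y \<in> D \<Longrightarrow> z \<in> A y \<Longrightarrow> \<phi> z \<le> \<phi> (nxt n y) + b * (1/2) ^ n"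
    by blast+
  define X where "X = rec_nat x0 nxt"
  have X0: "X 0 = x0" and XS: "X (Suc n) = nxt n (X n)" for n by (auto simp: X_def)
  have XD: "X n \<in> D" for n
    using x0 nxt(1) by (induction n) (auto simp: X0 XS A_def)
  have XA: "X (Suc n) \<in> A (X n)" for n using nxt(1)[OF XD] by (simp add: XS)
  have X_chain: "X m \<in> A (X n)" if "n \<le> m" for m n
    using that
  proof (induction rule: dec_induct)
    case base
    show ?case by (rule A_self[OF XD])
  next
    case (step m)
    then show ?case using XA[of m] A_trans by blast
  qed
  have gap: "q z (X (Suc n)) \<le> (1/2) ^ n" if z: "z \<in> A (X (Suc n))" for z n
  proof -
    have "b * q z (X (Suc n)) \<le> \<phi> z - \<phi> (X (Suc n))" using z by (simp add: A_def)
    also have "\<dots> \<le> b * (1/2) ^ n"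
      using nxt(2)[OF XD, of z n n] A_trans[OF XA[of n]] z by (auto simp: XS)
    finally show ?thesis using b by simp
  qed
  have "convergent (\<lambda>n. X (Suc n))"
    by (rule complete) (rule gap[OF XA])
  then obtain z where z: "X \<longlonglongrightarrow> z"
    by (auto simp: convergent_def filterlim_sequentially_Suc)
  have zA: "z \<in> A (X n)" for n
  proof -
    have lim: "(\<lambda>m. \<phi> (X n) + b * q (X m) (X n)) \<longlonglongrightarrow> \<phi> (X n) + b * q z (X n)"
      by (intro tendsto_intros cont z)
    have ge: "z \<in> D \<and> c \<le> \<phi> z" if "c < \<phi> (X n) + b * q z (X n)" for c
    proof (rule usc[OF XD z])
      show "\<forall>\<^sub>F m in sequentially. c \<le> \<phi> (X m)"
        using order_tendstoD(1)[OF lim that] eventually_ge_at_top[of n]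
      proof eventually_elim
        case (elim m)
        then show ?case using X_chain[of n m] by (auto simp: A_def)
      qed
    qed
    have "\<phi> (X n) + b * q z (X n) \<le> \<phi> z"
      by (rule dense_le) (use ge in blast)
    then show ?thesis using ge[of "\<phi> (X n) + b * q z (X n) - 1"] by (simp add: A_def)
  qed
  show ?thesis
  proof
    show "z \<in> D" "\<phi> x0 \<le> \<phi> z"
      using zA[of 0] A_ge[of z "X 0"] by (auto simp: A_def X0)
    fix x assume x: "x \<in> D"
    show "\<phi> x - b * q x z \<le> \<phi> z"
    proof (rule ccontr)
      assume neg: "\<not> ?thesis"
      then have "x \<in> A z" using x by (simp add: A_def)
      then have "x \<in> A (X n)" for n using A_trans[OF zA] by blast
      then have "q x (X (Suc n)) \<le> (1/2) ^ n" for n by (rule gap)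
      then have "(\<lambda>n. q x (X (Suc n))) \<longlonglongrightarrow> 0"
        by (intro Lim_null_comparison[OF _ LIMSEQ_realpow_zero[of "1/2"]]) (auto simp: nonneg)
      from separates[OF this, of z] have "x = z" using z by (simp add: filterlim_sequentially_Suc)
      then show False using neg by (simp add: self)
    qed
  qed
qed

section \<open>Slope and optimality at an Ekeland point\<close>

context evi_flow
begin

text \<open>Test the curve from \<open>x0\<close> at \<open>x\<close> over one unit of time: the squared distance on the left is
  nonnegative.\<close>

lemma energy_lower_bound:
  assumes "x0 \<in> dom"
  obtains C where "C \<ge> 0" "\<And>x. x \<in> dom \<Longrightarrow> - C - C * (dist x x0)\<^sup>2 \<le> e x"
proof -
  define w where "w = exp_weight K 1"
  have w: "w > 0" by (simp add: w_def exp_weight_pos K_nonneg)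
  define C where "C = \<bar>e (S 1 x0)\<bar> + 1 / (2 * w)"
  have "- C - C * (dist x x0)\<^sup>2 \<le> e x" if x: "x \<in> dom" for x
  proof -
    have "0 \<le> exp (- K * 1) * (dist (S 1 x0) x)\<^sup>2" by simp
    also have "\<dots> \<le> (dist x0 x)\<^sup>2 + 2 * (e x - e (S 1 x0)) * w"
      unfolding w_def by (rule integrated_evi[OF x]) simp
    finally have "2 * w * e (S 1 x0) - (dist x x0)\<^sup>2 \<le> 2 * w * e x"
      by (simp add: dist_commute algebra_simps)
    then have "e (S 1 x0) - (1 / (2 * w)) * (dist x x0)\<^sup>2 \<le> e x"
      using w by (simp add: field_simps)
    moreover have "(1 / (2 * w)) * (dist x x0)\<^sup>2 \<le> C * (dist x x0)\<^sup>2"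
      by (intro mult_right_mono) (auto simp: C_def)
    moreover have "- C \<le> e (S 1 x0)"
      using divide_pos_pos[of 1 "2 * w"] w unfolding C_def by linarith
    ultimately show ?thesis by linarith
  qed
  moreover have "C \<ge> 0" using w by (auto simp: C_def)
  ultimately show ?thesis using that by blast
qed

text \<open>A competitor \<open>\<sigma>\<close> at distance \<open>d\<close> whose energy is lower by more than \<open>s * d\<close> is tested in the
  integrated variational inequality at time \<open>t = d / s\<close>; the quadratic term costs about
  \<open>s\<^sup>2 * t / 2\<close> of the gain \<open>s\<^sup>2 * t\<close>, and the constant \<open>1 / 4\<close> leaves room for the exponential
  weight.\<close>

lemma slope_energy_drop:
  assumes r: "r \<in> dom" and s: "0 < s" "ereal s < local_slope E r"
  shows "\<exists>\<^sub>F t in at_right 0. e (S t r) \<le> e r - s\<^sup>2 / 4 * t"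
proof (rule ccontr)
  assume "\<not> ?thesis"
  then have "\<forall>\<^sub>F t in at_right 0. e r - s\<^sup>2 / 4 * t < e (S t r)"
    by (simp add: not_frequently not_le)
  moreover have "\<forall>\<^sub>F t in at_right 0. 2 / 3 < exp (- K * t)"
  proof -
    have "((\<lambda>t. exp (- K * t)) \<longlongrightarrow> exp (- K * 0)) (at_right 0)"
      by (intro tendsto_intros)
    then show ?thesis by (rule order_tendstoD) simp
  qed
  ultimately have "\<forall>\<^sub>F t in at_right 0. e r - s\<^sup>2 / 4 * t < e (S t r) \<and> 2 / 3 < exp (- K * t)"
    by (rule eventually_conj)
  then obtain \<delta> where \<delta>: "\<delta> > 0"
      "\<And>t. 0 < t \<Longrightarrow> t < \<delta> \<Longrightarrow> e r - s\<^sup>2 / 4 * t < e (S t r) \<and> 2 / 3 < exp (- K * t)"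
    by (auto simp: eventually_at_right_field)
  have "ereal s < Limsup (at r) (\<lambda>\<pi>. max 0 (E r - E \<pi>) / ereal (dist r \<pi>))"
    using s r by (auto simp: local_slope_def in_dom_iff less_max_iff_disj)
  then have "\<exists>\<^sub>F \<pi> in at r. ereal s < max 0 (E r - E \<pi>) / ereal (dist r \<pi>)"
    using Limsup_bounded[of "\<lambda>\<pi>. max 0 (E r - E \<pi>) / ereal (dist r \<pi>)" "ereal s" "at r"]
    by (auto simp: frequently_def not_less)
  moreover have "\<forall>\<^sub>F \<pi> in at r. \<pi> \<noteq> r \<and> dist \<pi> r < s * \<delta>"
    using s \<delta>(1) by (auto simp: eventually_at intro!: exI[of _ "s * \<delta>"])
  ultimately have "\<exists>\<^sub>F \<pi> in at r. ereal s < max 0 (E r - E \<pi>) / ereal (dist r \<pi>) \<and> \<pi> \<noteq> r \<and> dist \<pi> r < s * \<delta>"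
    by (rule frequently_eventually_frequently)
  then obtain \<sigma> where \<sigma>: "ereal s < max 0 (E r - E \<sigma>) / ereal (dist r \<sigma>)" "\<sigma> \<noteq> r" "dist r \<sigma> < s * \<delta>"
    by (auto simp: dist_commute dest: frequently_ex)
  define d where "d = dist r \<sigma>"
  define t where "t = d / s"
  have d: "d > 0" using \<sigma>(2) by (simp add: d_def)
  have t: "0 < t" "t < \<delta>" "d = s * t" using \<sigma>(3) s d by (auto simp: t_def d_def field_simps)
  have \<sigma>_dom: "\<sigma> \<in> dom"
    using \<sigma>(1) energy_eq[OF r] s by (cases "E \<sigma>") (auto simp: in_dom_iff max_def)
  have gain: "e \<sigma> < e r - s * d"
  proof -
    have "s < max 0 (e r - e \<sigma>) / d"
      using \<sigma>(1) d unfolding energy_eq[OF r] energy_eq[OF \<sigma>_dom]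
      by (auto simp: d_def[symmetric] max_def split: if_splits)
    then have "s * d < max 0 (e r - e \<sigma>)" using d by (simp add: pos_less_divide_eq)
    then show ?thesis using mult_pos_pos[OF s(1) d] by (simp add: max_def split: if_splits)
  qed
  define w where "w = exp_weight K t"
  have w: "w > 0" using exp_weight_pos[OF K_nonneg t(1)] by (simp add: w_def)
  have "t * (2 / 3) \<le> t * exp (- K * t)" using \<delta>(2)[OF t(1,2)] t(1) by (intro mult_left_mono) auto
  also have "\<dots> \<le> w" using exp_weight_bounds(2)[OF K_nonneg, of t] t(1) by (simp add: w_def)
  finally have tw: "t \<le> 3 / 2 * w" by simp
  have "0 \<le> exp (- K * t) * (dist (S t r) \<sigma>)\<^sup>2" by simp
  also have "\<dots> \<le> d\<^sup>2 + 2 * (e \<sigma> - e (S t r)) * w"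
    unfolding w_def d_def by (rule integrated_evi[OF \<sigma>_dom t(1)])
  finally have "2 * w * (e (S t r) - e \<sigma>) \<le> d\<^sup>2" by (simp add: algebra_simps)
  also have "d\<^sup>2 = s\<^sup>2 * t * t" by (simp add: t(3) power2_eq_square)
  also have "\<dots> \<le> s\<^sup>2 * t * (3 / 2 * w)" using tw t(1) by (intro mult_left_mono) auto
  finally have "2 * w * (e (S t r) - e \<sigma>) \<le> 2 * w * (3 / 4 * s\<^sup>2 * t)" by (simp add: algebra_simps)
  then have "e (S t r) - e \<sigma> \<le> 3 / 4 * s\<^sup>2 * t"
    using w by (subst (asm) mult_le_cancel_left_pos) auto
  then have "e (S t r) \<le> e r - s\<^sup>2 / 4 * t"
    using gain t(3) by (simp add: power2_eq_square)
  then show False using \<delta>(2)[OF t(1,2)] by linarith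
qed

text \<open>Both optimality conditions below concern a point \<open>\<rho>\<close> where the functional
  \<open>A/2 * d(\<cdot>,p)\<^sup>2 + B/2 * d(\<cdot>,q)\<^sup>2 + C/2 * d(\<cdot>,x0)\<^sup>2 + \<epsilon> * e\<close>, perturbed by \<open>b * dT \<cdot> \<rho>\<close>, is minimal;
  this is what the variational principle delivers for one block of variables.\<close>

definition penalised_minimiser ::
  "real \<Rightarrow> 'a \<Rightarrow> real \<Rightarrow> 'a \<Rightarrow> real \<Rightarrow> 'a \<Rightarrow> real \<Rightarrow> real \<Rightarrow> 'a \<Rightarrow> bool" where
  "penalised_minimiser A p B q C x0 \<epsilon> b \<rho> \<longleftrightarrow> \<rho> \<in> dom \<and> (\<forall>x\<in>dom.
     A/2 * (dist \<rho> p)\<^sup>2 + B/2 * (dist \<rho> q)\<^sup>2 + C/2 * (dist \<rho> x0)\<^sup>2 + \<epsilon> * e \<rho>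
     \<le> A/2 * (dist x p)\<^sup>2 + B/2 * (dist x q)\<^sup>2 + C/2 * (dist x x0)\<^sup>2 + \<epsilon> * e x + b * dT x \<rho>)"

text \<open>Competitors on the flow line through \<open>\<rho>\<close>: the variational inequality bounds the growth of the
  squared distances, and the dissipation of energy pays for the slope.\<close>

lemma penalised_minimiser_flow:
  assumes min: "penalised_minimiser A p B q C x0 \<epsilon> b \<rho>"
    and dom: "p \<in> dom" "q \<in> dom" "x0 \<in> dom"
    and nonneg: "A \<ge> 0" "B \<ge> 0" "C \<ge> 0" "b \<ge> 0" and \<epsilon>: "\<epsilon> > 0"
  obtains s where "s \<ge> 0" "local_slope E \<rho> = ereal s"
    "\<epsilon> / 4 * s\<^sup>2 \<le> A * (e p - e \<rho> + K / 2 * (dist \<rho> p)\<^sup>2) + B * (e q - e \<rho> + K / 2 * (dist \<rho> q)\<^sup>2)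
      + C * (e x0 - e \<rho> + K / 2 * (dist \<rho> x0)\<^sup>2) + b"
proof -
  define g where "g = (\<lambda>y. e y - e \<rho> + K / 2 * (dist \<rho> y)\<^sup>2)"
  define R where "R = A * g p + B * g q + C * g x0 + b"
  have \<rho>: "\<rho> \<in> dom" using min by (simp add: penalised_minimiser_def)
  have growth: "\<forall>\<^sub>F t in at_right 0. (dist (S t \<rho>) y)\<^sup>2 - (dist \<rho> y)\<^sup>2 \<le> 2 * (g y + \<delta>) * t"
    if "y \<in> dom" "\<delta> > 0" for y \<delta>
  proof -
    have "dini_le (\<lambda>s. (dist (S s \<rho>) y)\<^sup>2) 0 (2 * (e y - e \<rho>) + K * (dist (S 0 \<rho>) y)\<^sup>2)"
      using that \<rho> by (intro flow_dini) (auto simp: energy_eq)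
    then show ?thesis using that
      unfolding dini_le_def
      by (elim allE[of _ "2 * (g y + \<delta>)"]) (auto simp: g_def algebra_simps)
  qed
  \<comment> \<open>Also used with \<open>s = 0\<close>, where the hypothesis always holds, to see that \<open>R\<close> is nonnegative.\<close>
  have key: "\<epsilon> / 4 * s\<^sup>2 \<le> R" if s: "\<exists>\<^sub>F t in at_right 0. e (S t \<rho>) \<le> e \<rho> - s\<^sup>2 / 4 * t" for s
  proof (rule field_le_epsilon)
    fix \<eta> :: real assume "\<eta> > 0"
    define \<delta> where "\<delta> = \<eta> / (A + B + C + 1)"
    have \<delta>: "\<delta> > 0" "(A + B + C) * \<delta> \<le> \<eta>"
      using \<open>\<eta> > 0\<close> nonneg by (auto simp: \<delta>_def field_simps)
    have "\<forall>\<^sub>F t in at_right 0. 0 < t \<and>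
        (dist (S t \<rho>) p)\<^sup>2 - (dist \<rho> p)\<^sup>2 \<le> 2 * (g p + \<delta>) * t \<and>
        (dist (S t \<rho>) q)\<^sup>2 - (dist \<rho> q)\<^sup>2 \<le> 2 * (g q + \<delta>) * t \<and>
        (dist (S t \<rho>) x0)\<^sup>2 - (dist \<rho> x0)\<^sup>2 \<le> 2 * (g x0 + \<delta>) * t"
      by (intro eventually_conj growth dom \<delta>) (rule eventually_at_right_less)
    from frequently_eventually_frequently[OF s this] obtain t where t: "t > 0"
        "e (S t \<rho>) \<le> e \<rho> - s\<^sup>2 / 4 * t"
        "(dist (S t \<rho>) p)\<^sup>2 - (dist \<rho> p)\<^sup>2 \<le> 2 * (g p + \<delta>) * t"
        "(dist (S t \<rho>) q)\<^sup>2 - (dist \<rho> q)\<^sup>2 \<le> 2 * (g q + \<delta>) * t"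
        "(dist (S t \<rho>) x0)\<^sup>2 - (dist \<rho> x0)\<^sup>2 \<le> 2 * (g x0 + \<delta>) * t"
      by (auto dest!: frequently_ex)
    have "S t \<rho> \<in> dom" using flow_in_dom[OF t(1)] .
    then have "0 \<le> A/2 * ((dist (S t \<rho>) p)\<^sup>2 - (dist \<rho> p)\<^sup>2) + B/2 * ((dist (S t \<rho>) q)\<^sup>2 - (dist \<rho> q)\<^sup>2)
        + C/2 * ((dist (S t \<rho>) x0)\<^sup>2 - (dist \<rho> x0)\<^sup>2) + \<epsilon> * (e (S t \<rho>) - e \<rho>) + b * dT (S t \<rho>) \<rho>"
      using min by (auto simp: penalised_minimiser_def algebra_simps)
    also have "\<dots> \<le> A/2 * (2 * (g p + \<delta>) * t) + B/2 * (2 * (g q + \<delta>) * t)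
        + C/2 * (2 * (g x0 + \<delta>) * t) + \<epsilon> * (- (s\<^sup>2 / 4 * t)) + b * t"
      using t nonneg \<epsilon> tataru_flow_le[of t \<rho>] by (intro add_mono mult_left_mono) auto
    also have "\<dots> = (R + (A + B + C) * \<delta> - \<epsilon> / 4 * s\<^sup>2) * t"
      by (simp add: R_def algebra_simps)
    finally have "\<epsilon> / 4 * s\<^sup>2 \<le> R + (A + B + C) * \<delta>"
      using t(1) by (simp add: zero_le_mult_iff)
    then show "\<epsilon> / 4 * s\<^sup>2 \<le> R + \<eta>" using \<delta>(2) by linarith
  qed
  have key_slope: "\<epsilon> / 4 * s\<^sup>2 \<le> R" if "0 < s" "ereal s < local_slope E \<rho>" for s
    using key slope_energy_drop[OF \<rho> that] by blast
  have "R \<ge> 0"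
  proof -
    have "\<forall>\<^sub>F t in at_right 0. e (S t \<rho>) \<le> e \<rho> - 0\<^sup>2 / 4 * t"
      using eventually_at_right_less[of "0::real"] by eventually_elim (use e_flow_le[OF \<rho>] in auto)
    then show ?thesis using key[of 0] eventually_frequently[OF trivial_limit_at_right_real] by fastforce
  qed
  define m where "m = sqrt (4 * R / \<epsilon>)"
  have m: "m \<ge> 0" "\<epsilon> / 4 * m\<^sup>2 = R" using \<open>R \<ge> 0\<close> \<epsilon> by (auto simp: m_def)
  have "local_slope E \<rho> \<le> ereal m"
  proof (rule ccontr)
    assume "\<not> ?thesis"
    then have "ereal m < local_slope E \<rho>" by simp
    then obtain s where s: "m < s" "ereal s < local_slope E \<rho>"
      using ereal_dense2 by (metis less_ereal.simps(1))
    then have "\<epsilon> / 4 * m\<^sup>2 < \<epsilon> / 4 * s\<^sup>2" using m(1) \<epsilon> by (intro mult_strict_left_mono power_strict_mono) auto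
    then show False using key_slope[of s] s m by simp
  qed
  moreover have "0 \<le> local_slope E \<rho>" by (simp add: local_slope_def)
  ultimately obtain s where s: "local_slope E \<rho> = ereal s" "0 \<le> s" "s \<le> m"
    by (cases "local_slope E \<rho>") auto
  have "\<epsilon> / 4 * s\<^sup>2 \<le> R"
    unfolding m(2)[symmetric] using power_mono[OF s(3,2), of 2] \<epsilon> by (intro mult_left_mono) auto
  then show ?thesis using that[OF s(2,1)] by (simp add: R_def g_def)
qed

text \<open>Competitors on the approximate geodesic from \<open>\<rho>\<close> to \<open>p\<close>: to first order,
  moving by \<open>t\<close> gains \<open>t * A * d(\<rho>,p)\<^sup>2\<close> and costs at most \<open>t * d(\<rho>,p)\<close> times the right-hand
  side.\<close>

lemma penalised_minimiser_direction:
  assumes min: "penalised_minimiser A p B q C x0 \<epsilon> b \<rho>"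
    and regular: "slope_regular_geodesics E"
    and p: "p \<in> dom" and slope: "local_slope E \<rho> = ereal s" "s \<ge> 0"
    and nonneg: "A \<ge> 0" "B \<ge> 0" "C \<ge> 0" "b \<ge> 0" and \<epsilon>: "\<epsilon> > 0"
  shows "A * dist \<rho> p \<le> B * dist \<rho> q + C * dist \<rho> x0 + \<epsilon> * s + b"
proof (cases "\<rho> = p")
  case True
  then show ?thesis using nonneg \<epsilon> slope(2) by simp
next
  case False
  define L where "L = dist \<rho> p"
  have L: "L > 0" using False by (simp add: L_def)
  have \<rho>: "\<rho> \<in> dom" using min by (simp add: penalised_minimiser_def)
  have "information E \<rho> + E p < \<infinity>"
    using \<rho> energy_eq[OF p] by (simp add: information_def slope dom_def power2_eq_square)
  then obtain \<zeta> where \<zeta>: "geodesic \<zeta> \<rho> p" and approx: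
      "\<And>\<theta>. \<theta> > 0 \<Longrightarrow> \<exists>\<tau>>0. \<exists>z. z 0 = \<rho> \<and>
         Limsup (at 0 within {0..\<tau>}) (\<lambda>t. ereal (dist (z t) (\<zeta> t) / t)) \<le> ereal \<theta> \<and>
         Liminf (at 0 within {0..\<tau>}) (\<lambda>t. (E (z t) - E \<rho>) / ereal t) \<le> local_slope E \<rho> * ereal (dist \<rho> p + \<theta>)"
    using regular unfolding slope_regular_geodesics_def by blast
  \<comment> \<open>\<open>G \<theta>\<close> collects the terms of first order in \<open>t\<close>, for the curve of accuracy \<open>\<theta>\<close>; the factor \<open>2\<close>
    turns the bound by \<open>\<theta>\<close> on the upper limit into one that holds for small \<open>t\<close>.\<close>
  define G where "G = (\<lambda>\<theta>. A * (L * (2 * \<theta> - L)) + B * (dist \<rho> q * (L + 2 * \<theta>))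
    + C * (dist \<rho> x0 * (L + 2 * \<theta>)) + \<epsilon> * (s * (L + \<theta>) + \<theta>) + b * (L + 2 * \<theta>))"
  have G_nonneg: "0 \<le> G \<theta>" if \<theta>: "\<theta> > 0" for \<theta>
  proof (rule ccontr)
    assume "\<not> 0 \<le> G \<theta>"
    then have neg: "G \<theta> < 0" by simp
    define m where "m = L + 2 * \<theta>"
    have m: "m > 0" using L \<theta> by (simp add: m_def)
    define H where "H = A/2 * (2 * \<theta> - L)\<^sup>2 + B/2 * m\<^sup>2 + C/2 * m\<^sup>2"
    obtain \<tau> z where \<tau>: "\<tau> > 0" and z:
        "Limsup (at 0 within {0..\<tau>}) (\<lambda>t. ereal (dist (z t) (\<zeta> t) / t)) \<le> ereal \<theta>"
        "Liminf (at 0 within {0..\<tau>}) (\<lambda>t. (E (z t) - E \<rho>) / ereal t) \<le> ereal (s * (L + \<theta>))"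
      using approx[OF \<theta>] by (auto simp: slope L_def)
    have "ereal \<theta> < ereal (2 * \<theta>)" using \<theta> by simp
    with z(1) have "Limsup (at_right 0) (\<lambda>t. ereal (dist (z t) (\<zeta> t) / t)) < ereal (2 * \<theta>)"
      using \<tau> by (metis at_within_Icc_at_right le_less_trans)
    then have close: "\<forall>\<^sub>F t in at_right 0. ereal (dist (z t) (\<zeta> t) / t) < ereal (2 * \<theta>)"
      by (rule Limsup_lessD)
    have freq: "\<exists>\<^sub>F t in at_right 0. (E (z t) - E \<rho>) / ereal t < ereal (s * (L + \<theta>) + \<theta>)"
    proof (rule ccontr)
      assume "\<not> ?thesis"
      then have "ereal (s * (L + \<theta>) + \<theta>) \<le> Liminf (at_right 0) (\<lambda>t. (E (z t) - E \<rho>) / ereal t)"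
        by (intro Liminf_bounded) (simp add: not_frequently not_less)
      also have "\<dots> \<le> ereal (s * (L + \<theta>))" using z(2) \<tau> by (simp add: at_within_Icc_at_right)
      finally show False using \<theta> by simp
    qed
    have "((\<lambda>t. G \<theta> + t * H) \<longlongrightarrow> G \<theta> + 0 * H) (at_right 0)"
      by (intro tendsto_intros)
    then have "\<forall>\<^sub>F t in at_right 0. G \<theta> + t * H < 0"
      by (rule order_tendstoD) (use neg in simp)
    then have "\<forall>\<^sub>F t in at_right 0. G \<theta> + t * H < 0 \<and> ereal (dist (z t) (\<zeta> t) / t) < ereal (2 * \<theta>)
        \<and> t \<in> {0<..<1}"
      by (intro eventually_conj close eventually_at_right_real) auto
    from frequently_eventually_frequently[OF freq this]
    obtain t where t: "0 < t" "t < 1" "G \<theta> + t * H < 0" "dist (z t) (\<zeta> t) / t < 2 * \<theta>"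
        "(E (z t) - E \<rho>) / ereal t < ereal (s * (L + \<theta>) + \<theta>)"
      by (auto dest!: frequently_ex)
    have zt: "z t \<in> dom" and e_zt: "e (z t) - e \<rho> \<le> t * (s * (L + \<theta>) + \<theta>)"
    proof -
      show zt: "z t \<in> dom"
        using t(5) energy_eq[OF \<rho>] t(1) by (cases "E (z t)") (auto simp: in_dom_iff)
      have "(e (z t) - e \<rho>) / t < s * (L + \<theta>) + \<theta>"
        using t(5) t(1) unfolding energy_eq[OF \<rho>] energy_eq[OF zt] by simp
      then show "e (z t) - e \<rho> \<le> t * (s * (L + \<theta>) + \<theta>)"
        using t(1) by (simp add: field_simps)
    qed
    have near: "dist (z t) (\<zeta> t) \<le> 2 * \<theta> * t" using t(1,4) by (simp add: field_simps)
    have "dist (\<zeta> t) p = (1 - t) * L" "dist \<rho> (\<zeta> t) = t * L"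
    proof -
      have "dist (\<zeta> t) (\<zeta> 1) = \<bar>1 - t\<bar> * dist \<rho> p" "dist (\<zeta> 0) (\<zeta> t) = \<bar>t - 0\<bar> * dist \<rho> p"
        using \<zeta> t(1,2) unfolding geodesic_def by (meson atLeastAtMost_iff less_imp_le order_refl zero_le_one)+
      then show "dist (\<zeta> t) p = (1 - t) * L" "dist \<rho> (\<zeta> t) = t * L"
        using \<zeta> t(1,2) by (auto simp: geodesic_def L_def)
    qed
    then have zp: "dist (z t) p \<le> L + t * (2 * \<theta> - L)" and z\<rho>: "dist (z t) \<rho> \<le> t * m"
      using near dist_triangle[of "z t" p "\<zeta> t"] dist_triangle[of "z t" \<rho> "\<zeta> t"]
      by (auto simp: m_def algebra_simps dist_commute)
    have sq: "(dist (z t) y)\<^sup>2 - (dist \<rho> y)\<^sup>2 \<le> t * (2 * (dist \<rho> y * m)) + t\<^sup>2 * m\<^sup>2" for y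
    proof -
      have "dist (z t) y \<le> dist \<rho> y + t * m" using z\<rho> dist_triangle[of "z t" y \<rho>] by simp
      then have "(dist (z t) y)\<^sup>2 \<le> (dist \<rho> y + t * m)\<^sup>2" by (intro power_mono) auto
      then show ?thesis by (simp add: power2_eq_square algebra_simps)
    qed
    have sqp: "(dist (z t) p)\<^sup>2 - (dist \<rho> p)\<^sup>2 \<le> t * (2 * (L * (2 * \<theta> - L))) + t\<^sup>2 * (2 * \<theta> - L)\<^sup>2"
    proof -
      have "(dist (z t) p)\<^sup>2 \<le> (L + t * (2 * \<theta> - L))\<^sup>2" using zp by (intro power_mono) auto
      then show ?thesis by (simp add: power2_eq_square algebra_simps L_def)
    qed
    have "dT (z t) \<rho> \<le> t * m" using tataru_le_dist[of "z t" \<rho>] z\<rho> by simp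
    have "0 \<le> A/2 * ((dist (z t) p)\<^sup>2 - (dist \<rho> p)\<^sup>2) + B/2 * ((dist (z t) q)\<^sup>2 - (dist \<rho> q)\<^sup>2)
        + C/2 * ((dist (z t) x0)\<^sup>2 - (dist \<rho> x0)\<^sup>2) + \<epsilon> * (e (z t) - e \<rho>) + b * dT (z t) \<rho>"
      using min zt by (auto simp: penalised_minimiser_def algebra_simps)
    also have "\<dots> \<le> A/2 * (t * (2 * (L * (2 * \<theta> - L))) + t\<^sup>2 * (2 * \<theta> - L)\<^sup>2)
        + B/2 * (t * (2 * (dist \<rho> q * m)) + t\<^sup>2 * m\<^sup>2) + C/2 * (t * (2 * (dist \<rho> x0 * m)) + t\<^sup>2 * m\<^sup>2)
        + \<epsilon> * (t * (s * (L + \<theta>) + \<theta>)) + b * (t * m)"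
      using nonneg \<epsilon> \<open>dT (z t) \<rho> \<le> t * m\<close> by (intro add_mono mult_left_mono sq sqp e_zt) auto
    also have "\<dots> = t * (G \<theta> + t * H)"
      by (simp add: G_def H_def m_def power2_eq_square algebra_simps)
    also have "\<dots> < 0" using t(1,3) by (simp add: mult_less_0_iff)
    finally show False by simp
  qed
  have "(G \<longlongrightarrow> G 0) (at_right 0)"
    unfolding G_def by (intro tendsto_eq_intros | simp)+
  then have "0 \<le> G 0"
    by (rule tendsto_lowerbound) (auto intro: eventually_mono[OF eventually_at_right_less] G_nonneg)
  also have "G 0 = L * (B * dist \<rho> q + C * dist \<rho> x0 + \<epsilon> * s + b - A * L)"
    by (simp add: G_def algebra_simps)
  finally show ?thesis using L by (simp add: zero_le_mult_iff L_def)
qed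

end

section \<open>The viscosity inequality at a perturbed maximum\<close>

context evi_flow
begin

text \<open>The test function carries \<open>2 * b\<close> where the perturbed maximum has \<open>b\<close>: the surplus
  \<open>b * dT \<cdot> \<pi>\<close> forces the optimising sequence to converge to the maximum point \<open>\<pi>\<close>. Finiteness of
  the energy at \<open>\<pi>\<close> is then read off from lower semicontinuity.\<close>

lemma viscosity_inequality_at_maximum:
  assumes max: "\<And>x. \<psi> x - a/2 * (dist x \<rho>)\<^sup>2 - b * dT x \<pi> \<le> \<psi> \<pi> - a/2 * (dist \<pi> \<rho>)\<^sup>2"
    and f: "f = (\<lambda>x. a/2 * (dist x \<rho>)\<^sup>2 + 2 * b * dT x \<pi>)"
    and sup: "(\<lambda>n. ereal (\<psi> (x n) - f (x n))) \<longlonglongrightarrow> (SUP y. ereal (\<psi> y - f y))"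
    and limsup: "limsup (\<lambda>n. ereal (\<psi> (x n)) - ereal l * (ereal a * (E \<rho> - E (x n)) + ereal (G (x n)))
      - ereal (h (x n))) \<le> 0"
    and \<rho>: "\<rho> \<in> dom" and pos: "a > 0" "b > 0" "l > 0"
    and cont: "isCont G \<pi>" "isCont h \<pi>"
  shows "\<pi> \<in> dom" "\<psi> \<pi> \<le> h \<pi> + l * (a * (e \<rho> - e \<pi>) + G \<pi>)"
proof -
  define m where "m = \<psi> \<pi> - a/2 * (dist \<pi> \<rho>)\<^sup>2"
  have upper: "\<psi> y - f y \<le> m - b * dT y \<pi>" for y
    using max[of y] by (simp add: f m_def)
  have "(SUP y. ereal (\<psi> y - f y)) = ereal m"
  proof (rule antisym)
    have "\<psi> y - f y \<le> m" for y
      using upper[of y] mult_nonneg_nonneg[OF less_imp_le[OF pos(2)] tataru_nonneg[of y \<pi>]] by linarith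
    then show "(SUP y. ereal (\<psi> y - f y)) \<le> ereal m" by (intro SUP_least) simp
    have "ereal m = ereal (\<psi> \<pi> - f \<pi>)" by (simp add: f m_def)
    also have "\<dots> \<le> (SUP y. ereal (\<psi> y - f y))" by (rule SUP_upper) simp
    finally show "ereal m \<le> (SUP y. ereal (\<psi> y - f y))" .
  qed
  with sup have lim: "(\<lambda>n. \<psi> (x n) - f (x n)) \<longlonglongrightarrow> m" by simp
  have "(\<lambda>n. (m - (\<psi> (x n) - f (x n))) / b) \<longlonglongrightarrow> (m - m) / b"
    using pos by (intro tendsto_intros lim) auto
  then have lim0: "(\<lambda>n. (m - (\<psi> (x n) - f (x n))) / b) \<longlonglongrightarrow> 0" by simp
  have "norm (dT (x n) \<pi>) \<le> (m - (\<psi> (x n) - f (x n))) / b" for n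
    using upper[of "x n"] pos tataru_nonneg[of "x n" \<pi>] by (simp add: field_simps)
  then have "(\<lambda>n. dT (x n) \<pi>) \<longlonglongrightarrow> 0"
    by (intro Lim_null_comparison[OF _ lim0] always_eventually allI)
  then have x: "x \<longlonglongrightarrow> \<pi>" by (rule tataru_tendsto_0_imp_tendsto)
  have "(\<lambda>n. (\<psi> (x n) - f (x n)) + f (x n)) \<longlonglongrightarrow> m + (a/2 * (dist \<pi> \<rho>)\<^sup>2 + 2 * b * dT \<pi> \<pi>)"
    unfolding f by (intro tendsto_intros lim[unfolded f] tataru_tendsto x)
  then have \<psi>: "(\<lambda>n. \<psi> (x n)) \<longlonglongrightarrow> \<psi> \<pi>" by (simp add: m_def)
  \<comment> \<open>\<open>c y\<close> is the bound on \<open>e y\<close> equivalent to the viscosity inequality at \<open>y\<close>.\<close>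
  define c where "c = (\<lambda>y. (h y + l * a * e \<rho> + l * G y - \<psi> y) / (l * a))"
  have lac: "l * a * c y = h y + l * a * e \<rho> + l * G y - \<psi> y" for y
    using pos by (simp add: c_def)
  have c: "(\<lambda>n. c (x n)) \<longlonglongrightarrow> c \<pi>"
    unfolding c_def using pos by (intro tendsto_intros \<psi> isCont_tendsto_compose[OF cont(1) x]
        isCont_tendsto_compose[OF cont(2) x]) auto
  have bound: "E \<pi> \<le> ereal C" if C: "c \<pi> < C" for C
  proof -
    define \<delta> where "\<delta> = (C - c \<pi>) / 2"
    have \<delta>: "\<delta> > 0" using C by (simp add: \<delta>_def)
    have "limsup (\<lambda>n. ereal (\<psi> (x n)) - ereal l * (ereal a * (E \<rho> - E (x n)) + ereal (G (x n)))
        - ereal (h (x n))) < ereal (l * a * \<delta>)"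
      using limsup pos \<delta> by (auto intro!: le_less_trans[OF limsup])
    then have "\<forall>\<^sub>F n in sequentially. ereal (\<psi> (x n)) - ereal l * (ereal a * (E \<rho> - E (x n)) + ereal (G (x n)))
        - ereal (h (x n)) < ereal (l * a * \<delta>)"
      by (rule Limsup_lessD)
    moreover have "\<forall>\<^sub>F n in sequentially. c (x n) < c \<pi> + \<delta>"
      using \<delta> by (intro order_tendstoD(2)[OF c]) simp
    ultimately have "\<forall>\<^sub>F n in sequentially. x n \<in> {y. E y \<le> ereal C}"
    proof eventually_elim
      case (elim n)
      have dom: "x n \<in> dom"
        using elim(1) energy_eq[OF \<rho>] pos by (cases "E (x n)") (auto simp: in_dom_iff)
      have "\<psi> (x n) - l * (a * (e \<rho> - e (x n)) + G (x n)) - h (x n) < l * a * \<delta>"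
        using elim(1) unfolding energy_eq[OF \<rho>] energy_eq[OF dom] by simp
      then have "l * a * e (x n) < l * a * (c (x n) + \<delta>)"
        unfolding distrib_left lac by (simp add: algebra_simps)
      then have "e (x n) < c (x n) + \<delta>" using pos by simp
      then have "e (x n) \<le> C" using elim(2) by (simp add: \<delta>_def field_simps)
      then show ?case using energy_eq[OF dom] by simp
    qed
    from Lim_in_closed_set[OF lower_semicontinuous_closed_sublevel[OF lsc] this _ x]
    show ?thesis by simp
  qed
  show dom: "\<pi> \<in> dom" using bound[of "c \<pi> + 1"] by (intro in_domI[of _ "c \<pi> + 1"]) simp
  have "e \<pi> \<le> c \<pi>"
    by (rule dense_ge) (use bound energy_leD in blast)
  then have "l * a * e \<pi> \<le> l * a * c \<pi>" using pos by simp
  then show "\<psi> \<pi> \<le> h \<pi> + l * (a * (e \<rho> - e \<pi>) + G \<pi>)"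
    unfolding lac by (simp add: algebra_simps)
qed

lemma subsolution_inequality_at_maximum:
  assumes sub: "viscosity_subsolution (H_dagger E \<kappa> S) l h u"
    and max: "\<And>x. u x - a/2 * (dist x \<rho>)\<^sup>2 - b * dT x \<pi> \<le> u \<pi> - a/2 * (dist \<pi> \<rho>)\<^sup>2"
    and \<rho>: "\<rho> \<in> dom" and pos: "a > 0" "b > 0" "l > 0" and cont: "isCont h \<pi>"
  shows "\<pi> \<in> dom" "u \<pi> \<le> h \<pi> + l * (a * (e \<rho> - e \<pi>)
    + (- a * (\<kappa> / 2) * (dist \<pi> \<rho>)\<^sup>2 + 2 * b + 1/2 * a\<^sup>2 * (dist \<pi> \<rho>)\<^sup>2 + a * (2 * b) * dist \<pi> \<rho> + 1/2 * (2 * b)\<^sup>2))"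
proof -
  define G where "G = (\<lambda>\<pi>. - a * (\<kappa> / 2) * (dist \<pi> \<rho>)\<^sup>2 + 2 * b + 1/2 * a\<^sup>2 * (dist \<pi> \<rho>)\<^sup>2
    + a * (2 * b) * dist \<pi> \<rho> + 1/2 * (2 * b)\<^sup>2)"
  define f where "f = (\<lambda>x. a/2 * (dist x \<rho>)\<^sup>2 + 2 * b * dT x \<pi>)"
  have f': "f = (\<lambda>x. 1/2 * a * (dist x \<rho>)\<^sup>2 + (2 * b) * dT x \<pi> + 0)"
    by (simp add: f_def)
  have "(f, \<lambda>x. ereal a * (E \<rho> - E x) + ereal (G x)) \<in> H_dagger E \<kappa> S"
    unfolding H_dagger_def G_def f'
    using pos \<rho> by (intro CollectI exI[of _ a] exI[of _ "2 * b"] exI[of _ 0] exI[of _ \<pi>] exI[of _ \<rho>])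
      (simp add: in_dom_iff)
  then obtain x where "(\<lambda>n. ereal (u (x n) - f (x n))) \<longlonglongrightarrow> (SUP y. ereal (u y - f y))"
    "limsup (\<lambda>n. ereal (u (x n)) - ereal l * (ereal a * (E \<rho> - E (x n)) + ereal (G (x n))) - ereal (h (x n))) \<le> 0"
    using sub unfolding viscosity_subsolution_def by fast
  note * = viscosity_inequality_at_maximum[OF max f_def this \<rho> pos _ cont]
  have "isCont G \<pi>" unfolding G_def by (intro continuous_intros)
  from *[OF this] show "\<pi> \<in> dom" "u \<pi> \<le> h \<pi> + l * (a * (e \<rho> - e \<pi>)
    + (- a * (\<kappa> / 2) * (dist \<pi> \<rho>)\<^sup>2 + 2 * b + 1/2 * a\<^sup>2 * (dist \<pi> \<rho>)\<^sup>2 + a * (2 * b) * dist \<pi> \<rho> + 1/2 * (2 * b)\<^sup>2))"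
    unfolding G_def by blast+
qed

lemma supersolution_inequality_at_minimum:
  assumes super: "viscosity_supersolution (H_ddagger E \<kappa> S) l h v"
    and min: "\<And>x. - v x - a/2 * (dist x \<gamma>)\<^sup>2 - b * dT x \<mu> \<le> - v \<mu> - a/2 * (dist \<mu> \<gamma>)\<^sup>2"
    and \<gamma>: "\<gamma> \<in> dom" and pos: "a > 0" "b > 0" "l > 0" and cont: "isCont h \<mu>"
  shows "\<mu> \<in> dom" "- v \<mu> \<le> - h \<mu> + l * (a * (e \<gamma> - e \<mu>)
    - (a * (\<kappa> / 2) * (dist \<gamma> \<mu>)\<^sup>2 - 2 * b + 1/2 * a\<^sup>2 * (dist \<gamma> \<mu>)\<^sup>2 - a * (2 * b) * dist \<gamma> \<mu> - 1/2 * (2 * b)\<^sup>2))"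
proof -
  define G where "G = (\<lambda>\<mu>. a * (\<kappa> / 2) * (dist \<gamma> \<mu>)\<^sup>2 - 2 * b + 1/2 * a\<^sup>2 * (dist \<gamma> \<mu>)\<^sup>2
    - a * (2 * b) * dist \<gamma> \<mu> - 1/2 * (2 * b)\<^sup>2)"
  define f where "f = (\<lambda>x. a/2 * (dist x \<gamma>)\<^sup>2 + 2 * b * dT x \<mu>)"
  have f': "(\<lambda>x. - f x) = (\<lambda>x. - (1/2) * a * (dist \<gamma> x)\<^sup>2 - (2 * b) * dT x \<mu> + 0)"
    by (simp add: f_def dist_commute)
  have "(\<lambda>x. - f x, \<lambda>x. ereal a * (E x - E \<gamma>) + ereal (G x)) \<in> H_ddagger E \<kappa> S"
    unfolding H_ddagger_def G_def f'
    using pos \<gamma> by (intro CollectI exI[of _ a] exI[of _ "2 * b"] exI[of _ 0] exI[of _ \<mu>] exI[of _ \<gamma>])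
      (simp add: in_dom_iff)
  then obtain x where x: "(\<lambda>n. ereal (v (x n) - - f (x n))) \<longlonglongrightarrow> (INF y. ereal (v y - - f y))"
    "0 \<le> liminf (\<lambda>n. ereal (v (x n)) - ereal l * (ereal a * (E (x n) - E \<gamma>) + ereal (G (x n))) - ereal (h (x n)))"
    using super unfolding viscosity_supersolution_def by fast
  have "(\<lambda>n. - ereal (v (x n) - - f (x n))) \<longlonglongrightarrow> - (INF y. ereal (v y - - f y))"
    using x(1) by (rule tendsto_uminus_ereal)
  also have "- (INF y. ereal (v y - - f y)) = (SUP y. - ereal (v y - - f y))"
    by (rule ereal_SUP_uminus_eq[symmetric])
  finally have sup: "(\<lambda>n. ereal (- v (x n) - f (x n))) \<longlonglongrightarrow> (SUP y. ereal (- v y - f y))"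
    by simp
  have neg: "- (ereal (v y) - ereal l * (ereal a * (E y - E \<gamma>) + ereal (G y)) - ereal (h y))
    = ereal (- v y) - ereal l * (ereal a * (E \<gamma> - E y) + ereal (- G y)) - ereal (- h y)" for y
    using energy_not_minf[of y] pos by (cases "E y") (auto simp: energy_eq[OF \<gamma>] algebra_simps)
  have "limsup (\<lambda>n. - (ereal (v (x n)) - ereal l * (ereal a * (E (x n) - E \<gamma>) + ereal (G (x n))) - ereal (h (x n)))) \<le> 0"
    using x(2) by (simp only: ereal_Limsup_uminus) (simp add: ereal_uminus_le_reorder)
  then have limsup: "limsup (\<lambda>n. ereal (- v (x n)) - ereal l * (ereal a * (E \<gamma> - E (x n)) + ereal (- G (x n)))
      - ereal (- h (x n))) \<le> 0"
    by (simp only: neg)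
  have "isCont (\<lambda>y. - G y) \<mu>" "isCont (\<lambda>y. - h y) \<mu>"
    unfolding G_def by (intro continuous_intros cont)+
  note * = viscosity_inequality_at_maximum[where \<psi> = "\<lambda>y. - v y" and G = "\<lambda>y. - G y" and h = "\<lambda>y. - h y",
      OF min f_def sup limsup \<gamma> pos this]
  show "\<mu> \<in> dom" by (rule *(1))
  show "- v \<mu> \<le> - h \<mu> + l * (a * (e \<gamma> - e \<mu>)
    - (a * (\<kappa> / 2) * (dist \<gamma> \<mu>)\<^sup>2 - 2 * b + 1/2 * a\<^sup>2 * (dist \<gamma> \<mu>)\<^sup>2 - a * (2 * b) * dist \<gamma> \<mu> - 1/2 * (2 * b)\<^sup>2))"
    using *(2) by (simp only: G_def diff_conv_add_uminus)
qed

end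

section \<open>Summation of the inequalities\<close>

text \<open>The energy terms \<open>a * (e\<rho> - e\<pi>)\<close> and \<open>a * (e\<gamma> - e\<mu>)\<close> cancel against the two flow
  inequalities, and \<open>a\<^sup>2 / 2 * (D1\<^sup>2 - D3\<^sup>2)\<close> is controlled by the two directional ones. The products
  of a slope with \<open>Y = a * (D1 + D3)\<close> that arise there are absorbed by the squared slopes gained from
  the flow inequalities; since \<open>Y\<close> stays bounded as \<open>\<epsilon>\<close> tends to zero, what is left is of order
  \<open>\<eta>\<close>.\<close>

lemma hamiltonian_sum_estimate:
  fixes a \<epsilon> b \<eta> K \<kappa> C C0 D1 D2 D3 R G s\<rho> s\<gamma> e\<pi> e\<rho> e\<gamma> e\<mu> ex :: real
  assumes pos: "a > 0" "\<epsilon> > 0" "b > 0" "\<eta> \<ge> 0" "K \<ge> 0" "- \<kappa> \<le> K" "C \<ge> 0"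
    and dist: "D1 \<ge> 0" "D3 \<ge> 0"
    and flow\<rho>: "\<epsilon> / 4 * s\<rho>\<^sup>2 \<le> a * (e\<pi> - e\<rho> + K / 2 * D1\<^sup>2) + a * (e\<gamma> - e\<rho> + K / 2 * D2\<^sup>2)
        + \<epsilon> * C * (ex - e\<rho> + K / 2 * R\<^sup>2) + b"
    and flow\<gamma>: "\<epsilon> / 4 * s\<gamma>\<^sup>2 \<le> a * (e\<mu> - e\<gamma> + K / 2 * D3\<^sup>2) + a * (e\<rho> - e\<gamma> + K / 2 * D2\<^sup>2)
        + \<epsilon> * C * (ex - e\<gamma> + K / 2 * G\<^sup>2) + b"
    and dir\<rho>: "a * D1 \<le> a * D2 + \<epsilon> * C * R + \<epsilon> * s\<rho> + b"
    and dir\<gamma>: "a * D2 \<le> a * D3 + \<epsilon> * C * G + \<epsilon> * s\<gamma> + b"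
    and P: "a * (D1\<^sup>2 + D2\<^sup>2 + D3\<^sup>2) \<le> 12 * \<eta>"
    and T\<rho>: "R\<^sup>2 / 2 \<le> e\<rho> + C / 2 * R\<^sup>2 + C0" and T\<gamma>: "G\<^sup>2 / 2 \<le> e\<gamma> + C / 2 * G\<^sup>2 + C0"
    and T: "\<epsilon> * (e\<rho> + C / 2 * R\<^sup>2 + C0 + (e\<gamma> + C / 2 * G\<^sup>2 + C0)) \<le> 3 * \<eta>"
    and \<epsilon>_small: "\<epsilon> * (ex + C0) \<le> \<eta>" "\<epsilon> * (24 * a) \<le> 1"
    and b_small: "b \<le> 1" "b * (1 + 24 * a * \<eta>) \<le> \<eta>"
  shows "a * (e\<rho> - e\<pi>) + (- a * (\<kappa> / 2) * D1\<^sup>2 + 2 * b + 1/2 * a\<^sup>2 * D1\<^sup>2 + a * (2 * b) * D1 + 1/2 * (2 * b)\<^sup>2)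
    + (a * (e\<gamma> - e\<mu>) - (a * (\<kappa> / 2) * D3\<^sup>2 - 2 * b + 1/2 * a\<^sup>2 * D3\<^sup>2 - a * (2 * b) * D3 - 1/2 * (2 * b)\<^sup>2))
    \<le> (18 * K + 4 * C + 3 * C * (C + K) + 14) * \<eta>"
proof -
  define P where "P = D1\<^sup>2 + D2\<^sup>2 + D3\<^sup>2"
  define W where "W = R\<^sup>2 + G\<^sup>2"
  define Y where "Y = a * (D1 + D3)"
  have Y: "Y \<ge> 0" using pos dist by (simp add: Y_def)
  have aP: "a * P \<le> 12 * \<eta>" using P by (simp add: P_def)
  have Y2: "Y\<^sup>2 \<le> 24 * a * \<eta>"
  proof -
    have "2 * P - (D1 + D3)\<^sup>2 = (D1 - D3)\<^sup>2 + 2 * D2\<^sup>2"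
      by (simp add: P_def power2_eq_square algebra_simps)
    also have "\<dots> \<ge> 0" by simp
    finally have "(D1 + D3)\<^sup>2 \<le> 2 * P" by simp
    then have "a\<^sup>2 * (D1 + D3)\<^sup>2 \<le> a\<^sup>2 * (2 * P)" by (intro mult_left_mono) auto
    also have "\<dots> = 2 * a * (a * P)" by (simp add: power2_eq_square)
    also have "\<dots> \<le> 2 * a * (12 * \<eta>)" using pos aP by (intro mult_left_mono) auto
    finally show ?thesis by (simp add: Y_def power_mult_distrib)
  qed
  have \<epsilon>Y: "\<epsilon> * Y\<^sup>2 \<le> \<eta>"
  proof -
    have "\<epsilon> * Y\<^sup>2 \<le> \<epsilon> * (24 * a * \<eta>)" using pos Y2 by (intro mult_left_mono) auto
    also have "\<dots> = (\<epsilon> * (24 * a)) * \<eta>" by simp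
    also have "\<dots> \<le> 1 * \<eta>" using \<epsilon>_small pos by (intro mult_right_mono) auto
    finally show ?thesis by simp
  qed
  have bY: "b * Y \<le> \<eta>"
  proof -
    have "2 * Y \<le> 1 + Y\<^sup>2" using zero_le_power2[of "Y - 1"] by (simp add: power2_eq_square algebra_simps)
    then have "Y \<le> 1 + 24 * a * \<eta>" using Y Y2 by linarith
    then have "b * Y \<le> b * (1 + 24 * a * \<eta>)" using pos by (intro mult_left_mono) auto
    then show ?thesis using b_small by linarith
  qed
  have b\<eta>: "b \<le> \<eta>"
  proof -
    have "b * 1 \<le> b * (1 + 24 * a * \<eta>)" using pos by (intro mult_left_mono) auto
    then show ?thesis using b_small by simp
  qed
  have bb: "b\<^sup>2 \<le> \<eta>"
  proof -
    have "b * b \<le> b * 1" using b_small(1) pos by (intro mult_left_mono) auto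
    then show ?thesis using b\<eta> by (simp add: power2_eq_square)
  qed
  have W0: "0 \<le> W" by (simp add: W_def)
  have \<epsilon>W: "\<epsilon> * W \<le> 6 * \<eta>"
  proof -
    have "\<epsilon> * (W / 2) \<le> \<epsilon> * (e\<rho> + C / 2 * R\<^sup>2 + C0 + (e\<gamma> + C / 2 * G\<^sup>2 + C0))"
      using T\<rho> T\<gamma> pos by (intro mult_left_mono) (auto simp: W_def)
    then show ?thesis using T by simp
  qed
  have energy: "a * (e\<rho> - e\<pi>) + a * (e\<gamma> - e\<mu>)
      \<le> - (\<epsilon> / 4 * s\<rho>\<^sup>2 + \<epsilon> / 4 * s\<gamma>\<^sup>2) + 12 * K * \<eta> + 2 * C * \<eta> + 3 * C * (C + K) * \<eta> + 2 * b"
  proof -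
    have "a * K / 2 * (D1\<^sup>2 + 2 * D2\<^sup>2 + D3\<^sup>2) \<le> a * K / 2 * (2 * P)"
      using pos by (intro mult_left_mono) (auto simp: P_def)
    also have "\<dots> = K * (a * P)" by simp
    also have "\<dots> \<le> K * (12 * \<eta>)" by (intro mult_left_mono aP pos)
    finally have 1: "a * K / 2 * (D1\<^sup>2 + 2 * D2\<^sup>2 + D3\<^sup>2) \<le> 12 * K * \<eta>" by simp
    have "ex - e\<rho> + K / 2 * R\<^sup>2 + (ex - e\<gamma> + K / 2 * G\<^sup>2) \<le> 2 * (ex + C0) + (C + K) / 2 * W"
    proof -
      have "0 \<le> e\<rho> + C / 2 * R\<^sup>2 + C0" "0 \<le> e\<gamma> + C / 2 * G\<^sup>2 + C0"
        using T\<rho> T\<gamma> zero_le_power2[of R] zero_le_power2[of G] by linarith+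
      then show ?thesis by (simp add: W_def field_simps)
    qed
    then have "\<epsilon> * C * (ex - e\<rho> + K / 2 * R\<^sup>2 + (ex - e\<gamma> + K / 2 * G\<^sup>2))
        \<le> \<epsilon> * C * (2 * (ex + C0) + (C + K) / 2 * W)"
      using pos by (intro mult_left_mono) auto
    also have "\<dots> = 2 * C * (\<epsilon> * (ex + C0)) + C * (C + K) / 2 * (\<epsilon> * W)"
      by (simp add: algebra_simps)
    also have "\<dots> \<le> 2 * C * \<eta> + C * (C + K) / 2 * (6 * \<eta>)"
      using pos \<epsilon>_small(1) \<epsilon>W by (intro add_mono mult_left_mono) auto
    also have "\<dots> = 2 * C * \<eta> + 3 * C * (C + K) * \<eta>" by simp
    finally have 2: "\<epsilon> * C * (ex - e\<rho> + K / 2 * R\<^sup>2 + (ex - e\<gamma> + K / 2 * G\<^sup>2))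
        \<le> 2 * C * \<eta> + 3 * C * (C + K) * \<eta>" .
    from add_mono[OF flow\<rho> flow\<gamma>] have "a * (e\<rho> - e\<pi>) + a * (e\<gamma> - e\<mu>) \<le> - (\<epsilon> / 4 * s\<rho>\<^sup>2 + \<epsilon> / 4 * s\<gamma>\<^sup>2)
        + a * K / 2 * (D1\<^sup>2 + 2 * D2\<^sup>2 + D3\<^sup>2)
        + \<epsilon> * C * (ex - e\<rho> + K / 2 * R\<^sup>2 + (ex - e\<gamma> + K / 2 * G\<^sup>2)) + 2 * b"
      by (simp add: algebra_simps)
    then show ?thesis using 1 2 by linarith
  qed
  have curv: "- a * (\<kappa> / 2) * D1\<^sup>2 - a * (\<kappa> / 2) * D3\<^sup>2 \<le> 6 * K * \<eta>"
  proof -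
    have "- \<kappa> * (a / 2 * (D1\<^sup>2 + D3\<^sup>2)) \<le> K * (a / 2 * (D1\<^sup>2 + D3\<^sup>2))"
      using pos by (intro mult_right_mono) auto
    also have "\<dots> \<le> K * (a / 2 * P)"
      using pos by (intro mult_left_mono) (auto simp: P_def)
    also have "\<dots> \<le> K * (6 * \<eta>)" using aP pos by (intro mult_left_mono) auto
    finally show ?thesis by (simp add: algebra_simps)
  qed
  have quad: "1/2 * a\<^sup>2 * D1\<^sup>2 - 1/2 * a\<^sup>2 * D3\<^sup>2
      \<le> \<epsilon> / 4 * s\<rho>\<^sup>2 + \<epsilon> / 4 * s\<gamma>\<^sup>2 + 2 * C * \<eta> + \<eta> + b * Y"
  proof -
    define X where "X = \<epsilon> * (C * (R + G) + s\<rho> + s\<gamma>) + 2 * b"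
    have "a * (D1 - D3) \<le> X" using dir\<rho> dir\<gamma> by (simp add: X_def algebra_simps)
    then have "a * (D1 - D3) * (Y / 2) \<le> X * (Y / 2)" using Y by (intro mult_right_mono) auto
    also have "a * (D1 - D3) * (Y / 2) = 1/2 * a\<^sup>2 * D1\<^sup>2 - 1/2 * a\<^sup>2 * D3\<^sup>2"
      by (simp add: Y_def power2_eq_square field_simps)
    also have "X * (Y / 2) = \<epsilon> * C * (R * Y / 2 + G * Y / 2) + \<epsilon> * (s\<rho> * Y / 2 + s\<gamma> * Y / 2) + b * Y"
      by (simp add: X_def field_simps)
    also have "\<dots> \<le> \<epsilon> * C * ((R\<^sup>2 + Y\<^sup>2) / 4 + (G\<^sup>2 + Y\<^sup>2) / 4) + \<epsilon> * ((s\<rho>\<^sup>2 + Y\<^sup>2) / 4 + (s\<gamma>\<^sup>2 + Y\<^sup>2) / 4) + b * Y"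
    proof -
      have amgm: "x * Y / 2 \<le> (x\<^sup>2 + Y\<^sup>2) / 4" for x
        using zero_le_power2[of "x - Y"] by (simp add: power2_eq_square algebra_simps)
      show ?thesis using pos by (intro add_mono mult_left_mono order_refl amgm) auto
    qed
    also have "\<dots> = C / 4 * (\<epsilon> * W) + C / 2 * (\<epsilon> * Y\<^sup>2) + (\<epsilon> / 4 * s\<rho>\<^sup>2 + \<epsilon> / 4 * s\<gamma>\<^sup>2) + (\<epsilon> * Y\<^sup>2) / 2 + b * Y"
      by (simp add: W_def field_simps)
    also have "\<dots> \<le> C / 4 * (6 * \<eta>) + C / 2 * \<eta> + (\<epsilon> / 4 * s\<rho>\<^sup>2 + \<epsilon> / 4 * s\<gamma>\<^sup>2) + \<eta> / 2 + b * Y"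
      using pos \<epsilon>W \<epsilon>Y by (intro add_mono mult_left_mono order_refl) auto
    also have "\<dots> \<le> \<epsilon> / 4 * s\<rho>\<^sup>2 + \<epsilon> / 4 * s\<gamma>\<^sup>2 + 2 * C * \<eta> + \<eta> + b * Y"
      using pos by simp
    finally show ?thesis .
  qed
  have rest: "a * (2 * b) * D1 + a * (2 * b) * D3 = 2 * (b * Y)"
    by (simp add: Y_def algebra_simps)
  have sq: "1/2 * (2 * b)\<^sup>2 = 2 * b\<^sup>2" by (simp add: power2_eq_square)
  have "a * (e\<rho> - e\<pi>) + (- a * (\<kappa> / 2) * D1\<^sup>2 + 2 * b + 1/2 * a\<^sup>2 * D1\<^sup>2 + a * (2 * b) * D1 + 1/2 * (2 * b)\<^sup>2)
    + (a * (e\<gamma> - e\<mu>) - (a * (\<kappa> / 2) * D3\<^sup>2 - 2 * b + 1/2 * a\<^sup>2 * D3\<^sup>2 - a * (2 * b) * D3 - 1/2 * (2 * b)\<^sup>2))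
    = (a * (e\<rho> - e\<pi>) + a * (e\<gamma> - e\<mu>)) + (- a * (\<kappa> / 2) * D1\<^sup>2 - a * (\<kappa> / 2) * D3\<^sup>2)
      + (1/2 * a\<^sup>2 * D1\<^sup>2 - 1/2 * a\<^sup>2 * D3\<^sup>2) + 2 * (b * Y) + 4 * b + 4 * b\<^sup>2"
    unfolding sq rest[symmetric] by linarith
  also have "\<dots> \<le> 12 * K * \<eta> + 2 * C * \<eta> + 3 * C * (C + K) * \<eta> + 6 * K * \<eta> + 2 * C * \<eta> + 14 * \<eta>"
    using energy curv quad bY b\<eta> bb by linarith
  also have "\<dots> = (18 * K + 4 * C + 3 * C * (C + K) + 14) * \<eta>"
    by (simp add: algebra_simps)
  finally show ?thesis .
qed

section \<open>Doubling of variables\<close>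

locale doubling = evi_flow E \<kappa> S
  for E :: "'a::complete_space \<Rightarrow> ereal" and \<kappa> S +
  fixes u v :: "'a \<Rightarrow> real" and x0 :: 'a and B C :: real
  assumes usc_u: "upper_semicontinuous u" and lsc_v: "lower_semicontinuous v"
    and u_le: "u x \<le> B" and v_ge: "- B \<le> v x"
    and x0_dom: "x0 \<in> dom" and C_nonneg: "C \<ge> 0"
    and energy_ge: "x \<in> dom \<Longrightarrow> - C - C * (dist x x0)\<^sup>2 \<le> e x"
begin

text \<open>The energy corrected so as to dominate half the squared distance to \<open>x0\<close>.\<close>

definition T :: "'a \<Rightarrow> real" where
  "T x = e x + (2 * C + 1) / 2 * (dist x x0)\<^sup>2 + C"

text \<open>The inner points \<open>\<rho>\<close> and \<open>\<gamma>\<close> serve as the centres of the test functions for \<open>u\<close> and \<open>v\<close>, which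
  must have finite energy; the outer points, at which \<open>u\<close> and \<open>v\<close> are tested, are unrestricted.\<close>

definition \<Phi> :: "real \<Rightarrow> real \<Rightarrow> 'a \<Rightarrow> 'a \<Rightarrow> 'a \<Rightarrow> 'a \<Rightarrow> real" where
  "\<Phi> a \<epsilon> \<pi> \<rho> \<gamma> \<mu> = u \<pi> - v \<mu> - a/2 * ((dist \<pi> \<rho>)\<^sup>2 + (dist \<rho> \<gamma>)\<^sup>2 + (dist \<gamma> \<mu>)\<^sup>2) - \<epsilon> * (T \<rho> + T \<gamma>)"

lemma T_ge: "x \<in> dom \<Longrightarrow> (dist x x0)\<^sup>2 / 2 \<le> T x"
  using energy_ge[of x] by (simp add: T_def field_simps)

lemma T_nonneg: "x \<in> dom \<Longrightarrow> 0 \<le> T x"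
  using T_ge[of x] zero_le_power2[of "dist x x0"] by linarith

lemma e_le_T: "e x \<le> T x"
  using C_nonneg by (simp add: T_def)

lemma \<Phi>_upper_bound:
  assumes "a \<ge> 0" "\<epsilon> \<ge> 0" "\<rho> \<in> dom" "\<gamma> \<in> dom"
  shows "\<Phi> a \<epsilon> \<pi> \<rho> \<gamma> \<mu> \<le> 2 * B - \<epsilon> * (T \<rho> + T \<gamma>)"
proof -
  have "0 \<le> a/2 * ((dist \<pi> \<rho>)\<^sup>2 + (dist \<rho> \<gamma>)\<^sup>2 + (dist \<gamma> \<mu>)\<^sup>2)" using assms by simp
  then show ?thesis using u_le[of \<pi>] v_ge[of \<mu>] by (simp add: \<Phi>_def)
qed

text \<open>For \<open>\<epsilon> > 0\<close> a bound from below on \<open>\<Phi>\<close> bounds the energy of the inner points, so that the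
  limit stays in the domain.\<close>

lemma \<Phi>_superlevel_closed:
  assumes lim: "p \<longlonglongrightarrow> \<pi>" "r \<longlonglongrightarrow> \<rho>" "g \<longlonglongrightarrow> \<gamma>" "m \<longlonglongrightarrow> \<mu>"
    and dom: "\<And>n. r n \<in> dom" "\<And>n. g n \<in> dom" and pos: "a \<ge> 0" "\<epsilon> > 0"
    and ge: "\<forall>\<^sub>F n in sequentially. c \<le> \<Phi> a \<epsilon> (p n) (r n) (g n) (m n)"
  shows "\<rho> \<in> dom" "\<gamma> \<in> dom" "c \<le> \<Phi> a \<epsilon> \<pi> \<rho> \<gamma> \<mu>"
proof -
  define Ce where "Ce = (2 * B - c) / \<epsilon>"
  have T_bound: "T (r n) \<le> Ce" "T (g n) \<le> Ce" if "c \<le> \<Phi> a \<epsilon> (p n) (r n) (g n) (m n)" for n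
  proof -
    have "c \<le> 2 * B - \<epsilon> * (T (r n) + T (g n))"
      using that \<Phi>_upper_bound[of a \<epsilon> "r n" "g n" "p n" "m n"] dom pos by simp
    then have "T (r n) + T (g n) \<le> Ce" using pos by (simp add: Ce_def field_simps)
    then show "T (r n) \<le> Ce" "T (g n) \<le> Ce" using T_nonneg[OF dom(1), of n] T_nonneg[OF dom(2), of n] by linarith+
  qed
  have E_bound: "E y \<le> ereal Ce" if "T y \<le> Ce" "y \<in> dom" for y
    using that e_le_T[of y] by (simp add: energy_eq)
  have ev: "\<forall>\<^sub>F n in sequentially. r n \<in> {y. E y \<le> ereal Ce}" "\<forall>\<^sub>F n in sequentially. g n \<in> {y. E y \<le> ereal Ce}"
    using ge by (eventually_elim, use T_bound E_bound dom in blast)+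
  note closed = Lim_in_closed_set[OF lower_semicontinuous_closed_sublevel[OF lsc]]
  from closed[OF ev(1) _ lim(2)] closed[OF ev(2) _ lim(3)] show \<rho>: "\<rho> \<in> dom" and \<gamma>: "\<gamma> \<in> dom"
    by (auto intro: in_domI)
  show "c \<le> \<Phi> a \<epsilon> \<pi> \<rho> \<gamma> \<mu>"
  proof (rule field_le_epsilon)
    fix \<delta>' :: real assume "\<delta>' > 0"
    define \<delta> where "\<delta> = \<delta>' / (2 + 2 * \<epsilon>)"
    have "(2 + 2 * \<epsilon>) * \<delta> = \<delta>'" using pos by (simp add: \<delta>_def)
    then have \<delta>2: "2 * \<delta> + 2 * \<epsilon> * \<delta> = \<delta>'" by (simp only: distrib_right)
    have \<delta>: "\<delta> > 0" using \<open>\<delta>' > 0\<close> pos by (simp add: \<delta>_def)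
    have "\<forall>\<^sub>F z in nhds \<pi>. u z < u \<pi> + \<delta>"
      using usc_u \<delta> by (simp add: upper_semicontinuous_def)
    then have ev1: "\<forall>\<^sub>F n in sequentially. u (p n) < u \<pi> + \<delta>"
      using lim(1) by (rule eventually_compose_filterlim)
    have "\<forall>\<^sub>F z in nhds \<mu>. v \<mu> - \<delta> < v z"
      using lsc_v \<delta> by (simp add: lower_semicontinuous_def)
    then have ev2: "\<forall>\<^sub>F n in sequentially. v \<mu> - \<delta> < v (m n)"
      using lim(4) by (rule eventually_compose_filterlim)
    have ev_e: "\<forall>\<^sub>F n in sequentially. e y - \<delta> < e (q n)"
      if "q \<longlonglongrightarrow> y" "y \<in> dom" "\<And>n. q n \<in> dom" for q y
    proof -
      have "\<forall>\<^sub>F z in nhds y. ereal (e y - \<delta>) < E z"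
        using lsc \<delta> energy_eq[OF that(2)] by (simp add: lower_semicontinuous_def)
      then have "\<forall>\<^sub>F n in sequentially. ereal (e y - \<delta>) < E (q n)"
        using that(1) by (rule eventually_compose_filterlim)
      then show ?thesis using that(3) by (simp add: energy_eq)
    qed
    define F where "F = (\<lambda>\<pi>' \<rho>' \<gamma>' \<mu>'. u \<pi> + \<delta> - (v \<mu> - \<delta>)
      - a/2 * ((dist \<pi>' \<rho>')\<^sup>2 + (dist \<rho>' \<gamma>')\<^sup>2 + (dist \<gamma>' \<mu>')\<^sup>2)
      - \<epsilon> * (e \<rho> - \<delta> + (2 * C + 1) / 2 * (dist \<rho>' x0)\<^sup>2 + C + (e \<gamma> - \<delta> + (2 * C + 1) / 2 * (dist \<gamma>' x0)\<^sup>2 + C)))"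
    have "(\<lambda>n. F (p n) (r n) (g n) (m n)) \<longlonglongrightarrow> F \<pi> \<rho> \<gamma> \<mu>"
      unfolding F_def by (intro tendsto_intros lim)
    moreover have "\<forall>\<^sub>F n in sequentially. c \<le> F (p n) (r n) (g n) (m n)"
      using ge ev1 ev2 ev_e[OF lim(2) \<rho> dom(1)] ev_e[OF lim(3) \<gamma> dom(2)]
    proof eventually_elim
      case (elim n)
      have "\<epsilon> * (e \<rho> - \<delta> + (2 * C + 1) / 2 * (dist (r n) x0)\<^sup>2 + C + (e \<gamma> - \<delta> + (2 * C + 1) / 2 * (dist (g n) x0)\<^sup>2 + C))
          \<le> \<epsilon> * (T (r n) + T (g n))"
        using elim pos by (intro mult_left_mono) (auto simp: T_def)
      then show ?case using elim by (simp add: \<Phi>_def F_def)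
    qed
    ultimately have "c \<le> F \<pi> \<rho> \<gamma> \<mu>"
      by (rule tendsto_lowerbound) simp
    also have "\<dots> = \<Phi> a \<epsilon> \<pi> \<rho> \<gamma> \<mu> + \<delta>'"
      unfolding \<delta>2[symmetric] by (simp add: F_def \<Phi>_def T_def algebra_simps)
    finally show "c \<le> \<Phi> a \<epsilon> \<pi> \<rho> \<gamma> \<mu> + \<delta>'" .
  qed
qed

text \<open>The perturbations of the four coordinates add up to a quasi-metric on the product, so changing one
  coordinate at a time costs the Tataru distance of that coordinate only.\<close>

lemma ekeland_quadruple:
  assumes pos: "a \<ge> 0" "\<epsilon> > 0" "b > 0" and dom1: "\<rho>1 \<in> dom" "\<gamma>1 \<in> dom"
  obtains \<pi> \<rho> \<gamma> \<mu> where "\<rho> \<in> dom" "\<gamma> \<in> dom" "\<Phi> a \<epsilon> \<pi>1 \<rho>1 \<gamma>1 \<mu>1 \<le> \<Phi> a \<epsilon> \<pi> \<rho> \<gamma> \<mu>"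
    "\<And>x. \<Phi> a \<epsilon> x \<rho> \<gamma> \<mu> - b * dT x \<pi> \<le> \<Phi> a \<epsilon> \<pi> \<rho> \<gamma> \<mu>"
    "\<And>x. x \<in> dom \<Longrightarrow> \<Phi> a \<epsilon> \<pi> x \<gamma> \<mu> - b * dT x \<rho> \<le> \<Phi> a \<epsilon> \<pi> \<rho> \<gamma> \<mu>"
    "\<And>x. x \<in> dom \<Longrightarrow> \<Phi> a \<epsilon> \<pi> \<rho> x \<mu> - b * dT x \<gamma> \<le> \<Phi> a \<epsilon> \<pi> \<rho> \<gamma> \<mu>"
    "\<And>x. \<Phi> a \<epsilon> \<pi> \<rho> \<gamma> x - b * dT x \<mu> \<le> \<Phi> a \<epsilon> \<pi> \<rho> \<gamma> \<mu>"
proof -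
  let ?p1 = "\<lambda>z :: 'a \<times> 'a \<times> 'a \<times> 'a. fst z" and ?p2 = "\<lambda>z :: 'a \<times> 'a \<times> 'a \<times> 'a. fst (snd z)"
  let ?p3 = "\<lambda>z :: 'a \<times> 'a \<times> 'a \<times> 'a. fst (snd (snd z))" and ?p4 = "\<lambda>z :: 'a \<times> 'a \<times> 'a \<times> 'a. snd (snd (snd z))"
  define q where "q = (\<lambda>x y. dT (?p1 x) (?p1 y) + dT (?p2 x) (?p2 y) + dT (?p3 x) (?p3 y) + dT (?p4 x) (?p4 y))"
  define \<phi> where "\<phi> = (\<lambda>z. \<Phi> a \<epsilon> (?p1 z) (?p2 z) (?p3 z) (?p4 z))"
  define D where "D = {z. ?p2 z \<in> dom \<and> ?p3 z \<in> dom}"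
  have q_ge: "dT (?p1 x) (?p1 y) \<le> q x y" "dT (?p2 x) (?p2 y) \<le> q x y"
      "dT (?p3 x) (?p3 y) \<le> q x y" "dT (?p4 x) (?p4 y) \<le> q x y" for x y
    using tataru_nonneg[of "?p1 x" "?p1 y"] tataru_nonneg[of "?p2 x" "?p2 y"]
      tataru_nonneg[of "?p3 x" "?p3 y"] tataru_nonneg[of "?p4 x" "?p4 y"] by (auto simp: q_def)
  obtain z where z: "z \<in> D" "\<phi> (\<pi>1, \<rho>1, \<gamma>1, \<mu>1) \<le> \<phi> z" "\<And>x. x \<in> D \<Longrightarrow> \<phi> x - b * q x z \<le> \<phi> z"
  proof (rule ekeland_quasi_metric[of q D \<phi> "2 * B" b "(\<pi>1, \<rho>1, \<gamma>1, \<mu>1)"])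
    show "0 \<le> q x y" for x y unfolding q_def by (intro add_nonneg_nonneg tataru_nonneg)
    show "q x x = 0" for x by (simp add: q_def)
    show "q x z \<le> q x y + q y z" for x y z
      using tataru_triangle[of "?p1 x" "?p1 z" "?p1 y"] tataru_triangle[of "?p2 x" "?p2 z" "?p2 y"]
        tataru_triangle[of "?p3 x" "?p3 z" "?p3 y"] tataru_triangle[of "?p4 x" "?p4 z" "?p4 y"]
      by (simp add: q_def)
    show "(\<lambda>n. q (x n) z) \<longlonglongrightarrow> q y z" if "x \<longlonglongrightarrow> y" for x y z
      unfolding q_def by (intro tendsto_add tataru_tendsto tendsto_fst tendsto_snd that)
    show "x = z" if lim: "(\<lambda>n. q x (y n)) \<longlonglongrightarrow> 0" "y \<longlonglongrightarrow> z" for y x z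
    proof -
      have "(\<lambda>n. dT (?p1 x) (?p1 (y n))) \<longlonglongrightarrow> 0" "(\<lambda>n. dT (?p2 x) (?p2 (y n))) \<longlonglongrightarrow> 0"
        "(\<lambda>n. dT (?p3 x) (?p3 (y n))) \<longlonglongrightarrow> 0" "(\<lambda>n. dT (?p4 x) (?p4 (y n))) \<longlonglongrightarrow> 0"
        by (rule Lim_null_comparison[OF _ lim(1)], simp add: q_ge tataru_nonneg)+
      then have "?p1 x = ?p1 z" "?p2 x = ?p2 z" "?p3 x = ?p3 z" "?p4 x = ?p4 z"
        using lim(2) by (auto intro!: tataru_separates tendsto_fst tendsto_snd)
      then show ?thesis by (simp add: prod_eq_iff)
    qed
    show "convergent x" if step: "\<And>n. q (x (Suc n)) (x n) \<le> (1/2) ^ n" for x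
    proof -
      have "Cauchy (\<lambda>n. ?p1 (x n))" "Cauchy (\<lambda>n. ?p2 (x n))" "Cauchy (\<lambda>n. ?p3 (x n))" "Cauchy (\<lambda>n. ?p4 (x n))"
        by (rule tataru_Cauchy, rule order_trans[OF q_ge(1) step] order_trans[OF q_ge(2) step]
            order_trans[OF q_ge(3) step] order_trans[OF q_ge(4) step])+
      then obtain z1 z2 z3 z4 where "(\<lambda>n. ?p1 (x n)) \<longlonglongrightarrow> z1" "(\<lambda>n. ?p2 (x n)) \<longlonglongrightarrow> z2"
          "(\<lambda>n. ?p3 (x n)) \<longlonglongrightarrow> z3" "(\<lambda>n. ?p4 (x n)) \<longlonglongrightarrow> z4"
        unfolding Cauchy_convergent_iff convergent_def by blast
      then have "(\<lambda>n. (?p1 (x n), ?p2 (x n), ?p3 (x n), ?p4 (x n))) \<longlonglongrightarrow> (z1, z2, z3, z4)"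
        by (intro tendsto_Pair)
      then show ?thesis by (auto simp: convergent_def)
    qed
    show "y \<in> D \<and> c \<le> \<phi> y"
      if "\<And>n. x n \<in> D" "x \<longlonglongrightarrow> y" "\<forall>\<^sub>F n in sequentially. c \<le> \<phi> (x n)" for x y c
    proof -
      note * = \<Phi>_superlevel_closed[of "\<lambda>n. ?p1 (x n)" "?p1 y" "\<lambda>n. ?p2 (x n)" "?p2 y"
          "\<lambda>n. ?p3 (x n)" "?p3 y" "\<lambda>n. ?p4 (x n)" "?p4 y" a \<epsilon> c]
      show ?thesis
        using that pos unfolding D_def \<phi>_def
        by (intro conjI CollectI) (rule *; (intro tendsto_fst tendsto_snd)?; simp)+
    qed
    show "\<phi> x \<le> 2 * B" if "x \<in> D" for x
    proof -
      have "0 \<le> \<epsilon> * (T (?p2 x) + T (?p3 x))"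
        using that pos T_nonneg by (auto simp: D_def)
      then show ?thesis
        using \<Phi>_upper_bound[of a \<epsilon> "?p2 x" "?p3 x" "?p1 x" "?p4 x"] that pos by (auto simp: D_def \<phi>_def)
    qed
    show "(\<pi>1, \<rho>1, \<gamma>1, \<mu>1) \<in> D" using dom1 by (simp add: D_def)
  qed (use pos in auto)
  obtain \<pi> \<rho> \<gamma> \<mu> where z_eq: "z = (\<pi>, \<rho>, \<gamma>, \<mu>)" by (metis prod_cases4)
  have dom: "\<rho> \<in> dom" "\<gamma> \<in> dom" using z(1) by (auto simp: D_def z_eq)
  show ?thesis
  proof (rule that[OF dom])
    show "\<Phi> a \<epsilon> \<pi>1 \<rho>1 \<gamma>1 \<mu>1 \<le> \<Phi> a \<epsilon> \<pi> \<rho> \<gamma> \<mu>" using z(2) by (simp add: \<phi>_def z_eq)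
    fix x
    show "\<Phi> a \<epsilon> x \<rho> \<gamma> \<mu> - b * dT x \<pi> \<le> \<Phi> a \<epsilon> \<pi> \<rho> \<gamma> \<mu>"
      using z(3)[of "(x, \<rho>, \<gamma>, \<mu>)"] dom by (simp add: D_def \<phi>_def q_def z_eq)
    show "\<Phi> a \<epsilon> \<pi> \<rho> \<gamma> x - b * dT x \<mu> \<le> \<Phi> a \<epsilon> \<pi> \<rho> \<gamma> \<mu>"
      using z(3)[of "(\<pi>, \<rho>, \<gamma>, x)"] dom by (simp add: D_def \<phi>_def q_def z_eq)
    assume "x \<in> dom"
    then show "\<Phi> a \<epsilon> \<pi> x \<gamma> \<mu> - b * dT x \<rho> \<le> \<Phi> a \<epsilon> \<pi> \<rho> \<gamma> \<mu>" "\<Phi> a \<epsilon> \<pi> \<rho> x \<mu> - b * dT x \<gamma> \<le> \<Phi> a \<epsilon> \<pi> \<rho> \<gamma> \<mu>"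
      using z(3)[of "(\<pi>, x, \<gamma>, \<mu>)"] z(3)[of "(\<pi>, \<rho>, x, \<mu>)"] dom by (simp_all add: D_def \<phi>_def q_def z_eq)
  qed
qed

text \<open>The supremum is taken without the energy penalty; a penalty with \<open>\<epsilon>\<close> small in terms of one nearly
  optimal quadruple hardly lowers it.\<close>

definition M :: "real \<Rightarrow> real" where
  "M a = Sup {\<Phi> a 0 \<pi> \<rho> \<gamma> \<mu> | \<pi> \<rho> \<gamma> \<mu>. \<rho> \<in> dom \<and> \<gamma> \<in> dom}"

lemma \<Phi>_le_M:
  assumes "a \<ge> 0" "\<rho> \<in> dom" "\<gamma> \<in> dom"
  shows "\<Phi> a 0 \<pi> \<rho> \<gamma> \<mu> \<le> M a"
  unfolding M_def
proof (rule cSup_upper)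
  show "bdd_above {\<Phi> a 0 \<pi> \<rho> \<gamma> \<mu> | \<pi> \<rho> \<gamma> \<mu>. \<rho> \<in> dom \<and> \<gamma> \<in> dom}"
    using \<Phi>_upper_bound[OF assms(1), of 0] by (intro bdd_aboveI[of _ "2 * B"]) auto
qed (use assms in auto)

lemma less_M_obtains:
  assumes "c < M a"
  obtains \<pi> \<rho> \<gamma> \<mu> where "\<rho> \<in> dom" "\<gamma> \<in> dom" "c < \<Phi> a 0 \<pi> \<rho> \<gamma> \<mu>"
proof -
  have "{\<Phi> a 0 \<pi> \<rho> \<gamma> \<mu> | \<pi> \<rho> \<gamma> \<mu>. \<rho> \<in> dom \<and> \<gamma> \<in> dom} \<noteq> {}" using x0_dom by blast
  from less_cSupD[OF this, of c] assms that show ?thesis unfolding M_def by blast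
qed

lemma M_antimono:
  assumes "0 \<le> a" "a \<le> a'"
  shows "M a' \<le> M a"
proof (rule ccontr)
  assume "\<not> ?thesis"
  then have "M a < M a'" by simp
  then obtain \<pi> \<rho> \<gamma> \<mu> where *: "\<rho> \<in> dom" "\<gamma> \<in> dom" "M a < \<Phi> a' 0 \<pi> \<rho> \<gamma> \<mu>"
    by (rule less_M_obtains)
  have "\<Phi> a' 0 \<pi> \<rho> \<gamma> \<mu> \<le> \<Phi> a 0 \<pi> \<rho> \<gamma> \<mu>"
    using assms by (auto simp: \<Phi>_def intro!: mult_right_mono)
  with *(3) \<Phi>_le_M[OF assms(1) *(1,2), of \<pi> \<mu>] show False by simp
qed

text \<open>The diagonal value is approached with both inner points in the dense domain of the energy.\<close>

lemma diagonal_le_M: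
  assumes "a \<ge> 0"
  shows "u x - v x \<le> M a"
proof (rule field_le_epsilon)
  fix \<delta> :: real assume "\<delta> > 0"
  have "sqrt (\<delta> / (a + 1)) > 0" using \<open>\<delta> > 0\<close> assms by simp
  then obtain \<rho> where \<rho>: "\<rho> \<in> dom" "dist \<rho> x < sqrt (\<delta> / (a + 1))"
    using dom_dense[of x] unfolding closure_approachable by blast
  have "(dist x \<rho>)\<^sup>2 \<le> (sqrt (\<delta> / (a + 1)))\<^sup>2"
    using \<rho>(2) by (intro power_mono) (auto simp: dist_commute)
  then have "(dist x \<rho>)\<^sup>2 * (a + 1) \<le> \<delta>" using \<open>\<delta> > 0\<close> assms by (simp add: field_simps)
  moreover have "a * (dist x \<rho>)\<^sup>2 \<le> (dist x \<rho>)\<^sup>2 * (a + 1)" by (simp add: algebra_simps)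
  ultimately have "a * (dist x \<rho>)\<^sup>2 \<le> \<delta>" by linarith
  moreover have "\<Phi> a 0 x \<rho> \<rho> x = u x - v x - a * (dist x \<rho>)\<^sup>2"
    by (simp add: \<Phi>_def dist_commute)
  ultimately show "u x - v x \<le> M a + \<delta>"
    using \<Phi>_le_M[OF assms \<rho>(1) \<rho>(1), of x x] by linarith
qed

text \<open>A bounded decreasing function cannot drop by \<open>\<eta>\<close> at each doubling of \<open>a\<close>. The gap between \<open>a / 2\<close> and
  \<open>a\<close> bounds the distance penalty at near-optimal points.\<close>

lemma M_almost_constant:
  assumes "\<eta> > 0"
  obtains a where "a > a0" "a > 0" "M (a / 2) < M a + \<eta>"
proof -
  define f where "f = (\<lambda>j::nat. M (2 ^ j))"
  have "decseq f" unfolding f_def by (intro decseq_SucI M_antimono) auto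
  moreover have "\<forall>j. u x0 - v x0 \<le> f j" unfolding f_def by (intro allI diagonal_le_M) simp
  ultimately obtain L where "f \<longlonglongrightarrow> L" by (rule decseq_convergent) blast
  then have "(\<lambda>j. f j - f (Suc j)) \<longlonglongrightarrow> L - L"
    by (intro tendsto_diff) (auto simp: filterlim_sequentially_Suc)
  then have lim: "(\<lambda>j. f j - f (Suc j)) \<longlonglongrightarrow> 0" by simp
  have "\<forall>\<^sub>F j in sequentially. f j - f (Suc j) < \<eta>"
    using assms by (intro order_tendstoD(2)[OF lim])
  moreover have "\<forall>\<^sub>F j in sequentially. a0 < 2 ^ j"
  proof -
    obtain N where N: "a0 < 2 ^ N" using real_arch_pow[of 2 a0] by auto
    have "(2::real) ^ N \<le> 2 ^ j" if "N \<le> j" for j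
      using that by (rule power_increasing) simp
    with eventually_ge_at_top[of N] show ?thesis
      by (elim eventually_mono) (use N less_le_trans in blast)
  qed
  ultimately have "\<forall>\<^sub>F j in sequentially. f j - f (Suc j) < \<eta> \<and> a0 < 2 ^ j"
    by (rule eventually_conj)
  then obtain j where "f j - f (Suc j) < \<eta>" "a0 < 2 ^ j"
    by (auto dest: eventually_happens)
  moreover from this have "a0 < 2 ^ Suc j"
    using zero_less_power[of "2::real" j] unfolding power_Suc by linarith
  ultimately show ?thesis
    using that[of "2 ^ Suc j"] by (simp add: f_def)
qed

end

section \<open>The comparison principle\<close>

context doubling
begin

text \<open>The parameters are fixed one after the other: \<open>a\<close> from \<open>\<eta>\<close> and the modulus of continuity, then a
  nearly optimal quadruple for \<open>M a\<close>, then \<open>\<epsilon>\<close> from the energies of its inner points and \<open>b\<close> from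
  \<open>a\<close> and \<open>\<eta>\<close>. Ekeland's principle starts from that quadruple, so the perturbed maximum is still
  within \<open>2 * \<eta>\<close> of \<open>M a\<close>.\<close>

lemma comparison_estimate:
  assumes regular: "slope_regular_geodesics E" and l: "l > 0"
    and sub: "viscosity_subsolution (H_dagger E \<kappa> S) l h1 u"
    and super: "viscosity_supersolution (H_ddagger E \<kappa> S) l h2 v"
    and cont: "\<And>x. isCont h1 x" "\<And>x. isCont h2 x"
    and modulus: "\<And>x y. dist x y < \<delta> \<Longrightarrow> \<bar>h2 x - h2 y\<bar> \<le> \<eta>" and \<delta>: "\<delta> > 0" and \<eta>: "\<eta> > 0"
    and H: "\<And>x. h1 x - h2 x \<le> H" and C': "C' = 2 * C + 1"
  shows "u x - v x \<le> H + (3 + l * (18 * K + 4 * C' + 3 * C' * (C' + K) + 14)) * \<eta>"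
proof -
  define N where "N = 18 * K + 4 * C' + 3 * C' * (C' + K) + 14"
  obtain a where a: "a > 36 * \<eta> / \<delta>\<^sup>2" "a > 0" "M (a / 2) < M a + \<eta>"
    using M_almost_constant[OF \<eta>] by blast
  have "M a - \<eta> < M a" using \<eta> by simp
  then obtain \<pi>1 \<rho>1 \<gamma>1 \<mu>1 where z1: "\<rho>1 \<in> dom" "\<gamma>1 \<in> dom" "M a - \<eta> < \<Phi> a 0 \<pi>1 \<rho>1 \<gamma>1 \<mu>1"
    by (rule less_M_obtains)
  define Q where "Q = T \<rho>1 + T \<gamma>1 + \<bar>e x0 + C\<bar> + 1"
  have Q: "Q > 0" "T \<rho>1 + T \<gamma>1 \<le> Q" "e x0 + C \<le> Q"
    using T_nonneg[OF z1(1)] T_nonneg[OF z1(2)] by (auto simp: Q_def)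
  define \<epsilon> where "\<epsilon> = min (1 / (24 * a)) (\<eta> / Q)"
  have \<epsilon>: "\<epsilon> > 0" "\<epsilon> * (24 * a) \<le> 1" "\<epsilon> * Q \<le> \<eta>"
  proof -
    show "\<epsilon> > 0" using a Q \<eta> by (simp add: \<epsilon>_def)
    have "\<epsilon> \<le> 1 / (24 * a)" "\<epsilon> \<le> \<eta> / Q" by (simp_all add: \<epsilon>_def)
    then show "\<epsilon> * (24 * a) \<le> 1" "\<epsilon> * Q \<le> \<eta>" using a Q by (simp_all add: field_simps)
  qed
  have \<epsilon>Q: "\<epsilon> * (T \<rho>1 + T \<gamma>1) \<le> \<eta>" "\<epsilon> * (e x0 + C) \<le> \<eta>"
    using mult_left_mono[OF Q(2), of \<epsilon>] mult_left_mono[OF Q(3), of \<epsilon>] \<epsilon> by linarith+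
  define b where "b = min 1 (\<eta> / (1 + 24 * a * \<eta>))"
  have den: "1 + 24 * a * \<eta> > 0" using a \<eta> by (simp add: add_pos_pos)
  have b: "b > 0" "b \<le> 1" "b * (1 + 24 * a * \<eta>) \<le> \<eta>"
  proof -
    show "b > 0" "b \<le> 1" using den \<eta> by (simp_all add: b_def)
    have "b \<le> \<eta> / (1 + 24 * a * \<eta>)" by (simp add: b_def)
    then show "b * (1 + 24 * a * \<eta>) \<le> \<eta>" using den by (simp add: pos_le_divide_eq)
  qed
  obtain \<pi> \<rho> \<gamma> \<mu> where dom: "\<rho> \<in> dom" "\<gamma> \<in> dom"
    and ge1: "\<Phi> a \<epsilon> \<pi>1 \<rho>1 \<gamma>1 \<mu>1 \<le> \<Phi> a \<epsilon> \<pi> \<rho> \<gamma> \<mu>"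
    and opt: "\<And>x. \<Phi> a \<epsilon> x \<rho> \<gamma> \<mu> - b * dT x \<pi> \<le> \<Phi> a \<epsilon> \<pi> \<rho> \<gamma> \<mu>"
      "\<And>x. x \<in> dom \<Longrightarrow> \<Phi> a \<epsilon> \<pi> x \<gamma> \<mu> - b * dT x \<rho> \<le> \<Phi> a \<epsilon> \<pi> \<rho> \<gamma> \<mu>"
      "\<And>x. x \<in> dom \<Longrightarrow> \<Phi> a \<epsilon> \<pi> \<rho> x \<mu> - b * dT x \<gamma> \<le> \<Phi> a \<epsilon> \<pi> \<rho> \<gamma> \<mu>"
      "\<And>x. \<Phi> a \<epsilon> \<pi> \<rho> \<gamma> x - b * dT x \<mu> \<le> \<Phi> a \<epsilon> \<pi> \<rho> \<gamma> \<mu>"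
    using ekeland_quadruple[OF less_imp_le[OF a(2)] \<epsilon>(1) b(1) z1(1,2)] by metis
  define P where "P = (dist \<pi> \<rho>)\<^sup>2 + (dist \<rho> \<gamma>)\<^sup>2 + (dist \<gamma> \<mu>)\<^sup>2"
  define Z where "Z = \<epsilon> * (T \<rho> + T \<gamma>)"
  have P0: "P \<ge> 0" by (simp add: P_def)
  have Z0: "Z \<ge> 0" using T_nonneg[OF dom(1)] T_nonneg[OF dom(2)] \<epsilon>(1) by (simp add: Z_def)
  have near_max: "M a - 2 * \<eta> < u \<pi> - v \<mu> - a/2 * P - Z"
    using z1(3) ge1 \<epsilon>Q(1) by (simp add: \<Phi>_def P_def Z_def)
  \<comment> \<open>For the parameter \<open>a / 2\<close> the same point has half of the distance penalty, so this half is at most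
    the gap between \<open>M (a / 2)\<close> and \<open>M a\<close> up to \<open>2 * \<eta>\<close>.\<close>
  have "u \<pi> - v \<mu> - a/4 * P \<le> M (a / 2)"
    using \<Phi>_le_M[OF _ dom, of "a / 2" \<pi> \<mu>] a(2) by (simp add: \<Phi>_def P_def)
  with near_max a(3) have "a/4 * P + Z < 3 * \<eta>" by (simp add: field_simps)
  then have aP: "a * P \<le> 12 * \<eta>" and Z: "Z \<le> 3 * \<eta>"
    using Z0 mult_nonneg_nonneg[OF less_imp_le[OF a(2)] P0] by linarith+
  have sub_max: "u x - a/2 * (dist x \<rho>)\<^sup>2 - b * dT x \<pi> \<le> u \<pi> - a/2 * (dist \<pi> \<rho>)\<^sup>2" for x
    using opt(1)[of x] by (simp add: \<Phi>_def algebra_simps)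
  note sub_ineq = subsolution_inequality_at_maximum[OF sub sub_max dom(1) a(2) b(1) l cont(1)]
  have super_min: "- v x - a/2 * (dist x \<gamma>)\<^sup>2 - b * dT x \<mu> \<le> - v \<mu> - a/2 * (dist \<mu> \<gamma>)\<^sup>2" for x
    using opt(4)[of x] by (simp add: \<Phi>_def algebra_simps dist_commute)
  note super_ineq = supersolution_inequality_at_minimum[OF super super_min dom(2) a(2) b(1) l cont(2)]
  have min\<rho>: "penalised_minimiser a \<pi> a \<gamma> (\<epsilon> * C') x0 \<epsilon> b \<rho>"
    unfolding penalised_minimiser_def
  proof (intro conjI ballI dom(1))
    fix x assume "x \<in> dom"
    from opt(2)[OF this] show "a / 2 * (dist \<rho> \<pi>)\<^sup>2 + a / 2 * (dist \<rho> \<gamma>)\<^sup>2 + \<epsilon> * C' / 2 * (dist \<rho> x0)\<^sup>2 + \<epsilon> * e \<rho>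
      \<le> a / 2 * (dist x \<pi>)\<^sup>2 + a / 2 * (dist x \<gamma>)\<^sup>2 + \<epsilon> * C' / 2 * (dist x x0)\<^sup>2 + \<epsilon> * e x + b * dT x \<rho>"
      by (simp add: \<Phi>_def T_def C' dist_commute[of \<pi>] field_simps)
  qed
  have min\<gamma>: "penalised_minimiser a \<rho> a \<mu> (\<epsilon> * C') x0 \<epsilon> b \<gamma>"
    unfolding penalised_minimiser_def
  proof (intro conjI ballI dom(2))
    fix x assume "x \<in> dom"
    from opt(3)[OF this] show "a / 2 * (dist \<gamma> \<rho>)\<^sup>2 + a / 2 * (dist \<gamma> \<mu>)\<^sup>2 + \<epsilon> * C' / 2 * (dist \<gamma> x0)\<^sup>2 + \<epsilon> * e \<gamma>
      \<le> a / 2 * (dist x \<rho>)\<^sup>2 + a / 2 * (dist x \<mu>)\<^sup>2 + \<epsilon> * C' / 2 * (dist x x0)\<^sup>2 + \<epsilon> * e x + b * dT x \<gamma>"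
      by (simp add: \<Phi>_def T_def C' dist_commute[of \<rho>] field_simps)
  qed
  have nonneg: "a \<ge> 0" "a \<ge> 0" "\<epsilon> * C' \<ge> 0" "b \<ge> 0" "C' \<ge> 0"
    using a(2) \<epsilon>(1) C_nonneg b(1) by (auto simp: C')
  obtain s\<rho> where s\<rho>: "s\<rho> \<ge> 0" "local_slope E \<rho> = ereal s\<rho>"
    "\<epsilon> / 4 * s\<rho>\<^sup>2 \<le> a * (e \<pi> - e \<rho> + K / 2 * (dist \<rho> \<pi>)\<^sup>2) + a * (e \<gamma> - e \<rho> + K / 2 * (dist \<rho> \<gamma>)\<^sup>2)
      + \<epsilon> * C' * (e x0 - e \<rho> + K / 2 * (dist \<rho> x0)\<^sup>2) + b"
    using penalised_minimiser_flow[OF min\<rho> sub_ineq(1) dom(2) x0_dom nonneg(1-4) \<epsilon>(1)] by blast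
  obtain s\<gamma> where s\<gamma>: "s\<gamma> \<ge> 0" "local_slope E \<gamma> = ereal s\<gamma>"
    "\<epsilon> / 4 * s\<gamma>\<^sup>2 \<le> a * (e \<rho> - e \<gamma> + K / 2 * (dist \<gamma> \<rho>)\<^sup>2) + a * (e \<mu> - e \<gamma> + K / 2 * (dist \<gamma> \<mu>)\<^sup>2)
      + \<epsilon> * C' * (e x0 - e \<gamma> + K / 2 * (dist \<gamma> x0)\<^sup>2) + b"
    using penalised_minimiser_flow[OF min\<gamma> dom(1) super_ineq(1) x0_dom nonneg(1-4) \<epsilon>(1)] by blast
  have dir\<rho>: "a * dist \<rho> \<pi> \<le> a * dist \<rho> \<gamma> + \<epsilon> * C' * dist \<rho> x0 + \<epsilon> * s\<rho> + b"
    by (rule penalised_minimiser_direction[OF min\<rho> regular sub_ineq(1) s\<rho>(2,1) nonneg(1-4) \<epsilon>(1)])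
  have dir\<gamma>: "a * dist \<gamma> \<rho> \<le> a * dist \<gamma> \<mu> + \<epsilon> * C' * dist \<gamma> x0 + \<epsilon> * s\<gamma> + b"
    by (rule penalised_minimiser_direction[OF min\<gamma> regular dom(1) s\<gamma>(2,1) nonneg(1-4) \<epsilon>(1)])
  have T_eq: "T y = e y + C' / 2 * (dist y x0)\<^sup>2 + C" for y by (simp add: T_def C')
  let ?g1 = "a * (e \<rho> - e \<pi>) + (- a * (\<kappa> / 2) * (dist \<pi> \<rho>)\<^sup>2 + 2 * b + 1/2 * a\<^sup>2 * (dist \<pi> \<rho>)\<^sup>2
      + a * (2 * b) * dist \<pi> \<rho> + 1/2 * (2 * b)\<^sup>2)"
  let ?g2 = "a * (e \<gamma> - e \<mu>) - (a * (\<kappa> / 2) * (dist \<gamma> \<mu>)\<^sup>2 - 2 * b + 1/2 * a\<^sup>2 * (dist \<gamma> \<mu>)\<^sup>2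
      - a * (2 * b) * dist \<gamma> \<mu> - 1/2 * (2 * b)\<^sup>2)"
  have "?g1 + ?g2 \<le> N * \<eta>"
    unfolding N_def
  proof (rule hamiltonian_sum_estimate)
    show "\<epsilon> / 4 * s\<rho>\<^sup>2 \<le> a * (e \<pi> - e \<rho> + K / 2 * (dist \<pi> \<rho>)\<^sup>2) + a * (e \<gamma> - e \<rho> + K / 2 * (dist \<rho> \<gamma>)\<^sup>2)
        + \<epsilon> * C' * (e x0 - e \<rho> + K / 2 * (dist \<rho> x0)\<^sup>2) + b"
      using s\<rho>(3) by (simp add: dist_commute)
    show "\<epsilon> / 4 * s\<gamma>\<^sup>2 \<le> a * (e \<mu> - e \<gamma> + K / 2 * (dist \<gamma> \<mu>)\<^sup>2) + a * (e \<rho> - e \<gamma> + K / 2 * (dist \<rho> \<gamma>)\<^sup>2)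
        + \<epsilon> * C' * (e x0 - e \<gamma> + K / 2 * (dist \<gamma> x0)\<^sup>2) + b"
      using s\<gamma>(3) unfolding dist_commute[of \<gamma> \<rho>] by linarith
    show "a * dist \<pi> \<rho> \<le> a * dist \<rho> \<gamma> + \<epsilon> * C' * dist \<rho> x0 + \<epsilon> * s\<rho> + b"
      using dir\<rho> by (simp add: dist_commute)
    show "a * dist \<rho> \<gamma> \<le> a * dist \<gamma> \<mu> + \<epsilon> * C' * dist \<gamma> x0 + \<epsilon> * s\<gamma> + b"
      using dir\<gamma> by (simp add: dist_commute)
    show "(dist \<rho> x0)\<^sup>2 / 2 \<le> e \<rho> + C' / 2 * (dist \<rho> x0)\<^sup>2 + C"
      "(dist \<gamma> x0)\<^sup>2 / 2 \<le> e \<gamma> + C' / 2 * (dist \<gamma> x0)\<^sup>2 + C"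
      using T_ge[OF dom(1)] T_ge[OF dom(2)] by (simp_all only: T_eq)
    show "\<epsilon> * (e \<rho> + C' / 2 * (dist \<rho> x0)\<^sup>2 + C + (e \<gamma> + C' / 2 * (dist \<gamma> x0)\<^sup>2 + C)) \<le> 3 * \<eta>"
      using Z by (simp only: Z_def T_eq)
    show "a * ((dist \<pi> \<rho>)\<^sup>2 + (dist \<rho> \<gamma>)\<^sup>2 + (dist \<gamma> \<mu>)\<^sup>2) \<le> 12 * \<eta>"
      using aP by (simp only: P_def)
  qed (use a \<epsilon> b \<epsilon>Q \<eta> K_nonneg K_ge nonneg in auto)
  then have lN: "l * (?g1 + ?g2) \<le> l * (N * \<eta>)" using l by (intro mult_left_mono) auto
  have "dist \<pi> \<mu> < \<delta>"
  proof -
    have "dist \<pi> \<mu> \<le> dist \<pi> \<rho> + dist \<rho> \<gamma> + dist \<gamma> \<mu>"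
      using dist_triangle[of \<pi> \<mu> \<rho>] dist_triangle[of \<rho> \<mu> \<gamma>] by linarith
    then have "(dist \<pi> \<mu>)\<^sup>2 \<le> (dist \<pi> \<rho> + dist \<rho> \<gamma> + dist \<gamma> \<mu>)\<^sup>2" by (intro power_mono) auto
    also have "\<dots> \<le> 3 * P"
    proof -
      have "3 * P - (dist \<pi> \<rho> + dist \<rho> \<gamma> + dist \<gamma> \<mu>)\<^sup>2
          = (dist \<pi> \<rho> - dist \<rho> \<gamma>)\<^sup>2 + (dist \<rho> \<gamma> - dist \<gamma> \<mu>)\<^sup>2 + (dist \<pi> \<rho> - dist \<gamma> \<mu>)\<^sup>2"
        by (simp add: P_def power2_eq_square algebra_simps)
      also have "\<dots> \<ge> 0" by simp
      finally show ?thesis by simp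
    qed
    finally have "a * (dist \<pi> \<mu>)\<^sup>2 \<le> a * (3 * P)" using a(2) by (intro mult_left_mono) auto
    also have "\<dots> \<le> 36 * \<eta>" using aP by (simp add: mult.commute)
    also have "\<dots> < a * \<delta>\<^sup>2" using a(1) \<delta> by (simp add: field_simps)
    finally have "(dist \<pi> \<mu>)\<^sup>2 < \<delta>\<^sup>2" using a(2) by simp
    then show ?thesis by (rule power2_less_imp_less) (use \<delta> in simp)
  qed
  from modulus[OF this] have "h1 \<pi> - h2 \<mu> \<le> H + \<eta>" using H[of \<pi>] by linarith
  moreover have "u \<pi> - v \<mu> \<le> h1 \<pi> - h2 \<mu> + l * (?g1 + ?g2)"
    using sub_ineq(2) super_ineq(2) unfolding distrib_left[of l ?g1 ?g2] by linarith
  moreover have "M a \<le> u \<pi> - v \<mu> + 2 * \<eta>"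
    using near_max Z0 mult_nonneg_nonneg[OF less_imp_le[OF a(2)] P0] by linarith
  moreover have "u x - v x \<le> M a" using a(2) by (intro diagonal_le_M) simp
  ultimately have "u x - v x \<le> H + 3 * \<eta> + l * (N * \<eta>)" using lN by linarith
  then show ?thesis by (simp add: N_def algebra_simps)
qed

end

theorem theorem2p13:
  fixes \<E> :: "'a::complete_space \<Rightarrow> ereal"
    and \<kappa> l :: real
    and S :: "real \<Rightarrow> 'a \<Rightarrow> 'a"
    and h_dagger h_ddagger u v :: "'a \<Rightarrow> real"
  assumes "\<And>\<pi>. \<E> \<pi> \<noteq> -\<infinity>"
    and "geodesic_space TYPE('a)"
    and "lower_semicontinuous \<E>"
    and "energy_domain \<E> \<noteq> {}"
    and "EVI_gradient_flow \<E> \<kappa> UNIV S"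
    and "slope_regular_geodesics \<E>"
    and "l > 0"
    and "bounded (range h_dagger)" and "uniformly_continuous_on UNIV h_dagger"
    and "bounded (range h_ddagger)" and "uniformly_continuous_on UNIV h_ddagger"
    and "viscosity_subsolution (H_dagger \<E> \<kappa> S) l h_dagger u"
    and "viscosity_supersolution (H_ddagger \<E> \<kappa> S) l h_ddagger v"
  shows "(SUP \<pi>. u \<pi> - v \<pi>) \<le> (SUP \<pi>. h_dagger \<pi> - h_ddagger \<pi>)"
proof -
  interpret evi_flow \<E> \<kappa> S
    using assms(1,3,5) by unfold_locales auto
  obtain x0 where x0: "x0 \<in> dom" using assms(4) by (auto simp: dom_def)
  obtain C where C: "C \<ge> 0" "\<And>x. x \<in> dom \<Longrightarrow> - C - C * (dist x x0)\<^sup>2 \<le> e x"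
    by (rule energy_lower_bound[OF x0]) blast
  have "bounded (range u)" "upper_semicontinuous u" "bounded (range v)" "lower_semicontinuous v"
    using assms(12,13) by (auto simp: viscosity_subsolution_def viscosity_supersolution_def)
  then obtain Bu Bv where B: "\<And>x. \<bar>u x\<bar> \<le> Bu" "\<And>x. \<bar>v x\<bar> \<le> Bv"
    by (auto simp: bounded_iff)
  interpret doubling \<E> \<kappa> S u v x0 "max Bu Bv" C
  proof
    show "u x \<le> max Bu Bv" "- max Bu Bv \<le> v x" for x
      using B(1)[of x] B(2)[of x] by (auto simp: abs_le_iff)
  qed fact+
  obtain B1 B2 where Bh: "\<And>x. \<bar>h_dagger x\<bar> \<le> B1" "\<And>x. \<bar>h_ddagger x\<bar> \<le> B2"
    using assms(8,10) by (auto simp: bounded_iff)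
  define H where "H = (SUP \<pi>. h_dagger \<pi> - h_ddagger \<pi>)"
  have H: "h_dagger x - h_ddagger x \<le> H" for x
    unfolding H_def
  proof (rule cSUP_upper)
    have "h_dagger y - h_ddagger y \<le> B1 + B2" for y using Bh(1)[of y] Bh(2)[of y] by linarith
    then show "bdd_above (range (\<lambda>\<pi>. h_dagger \<pi> - h_ddagger \<pi>))"
      by (intro bdd_aboveI[of _ "B1 + B2"]) auto
  qed simp
  have cont: "isCont h_dagger x" "isCont h_ddagger x" for x
    using assms(9,11) uniformly_continuous_imp_continuous continuous_on_eq_continuous_at[of UNIV] by auto
  define C' where "C' = 2 * C + 1"
  define N where "N = 3 + l * (18 * K + 4 * C' + 3 * C' * (C' + K) + 14)"
  have N: "N > 0"
    using C(1) K_nonneg assms(7) by (auto simp: N_def C'_def intro!: add_pos_nonneg mult_nonneg_nonneg add_nonneg_nonneg)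
  have "u x - v x \<le> H" for x
  proof (rule field_le_epsilon)
    fix \<epsilon> :: real assume "\<epsilon> > 0"
    define \<eta> where "\<eta> = \<epsilon> / N"
    have \<eta>: "\<eta> > 0" using \<open>\<epsilon> > 0\<close> N by (simp add: \<eta>_def)
    obtain \<delta> where \<delta>: "\<delta> > 0" "\<And>x y. dist x y < \<delta> \<Longrightarrow> dist (h_ddagger x) (h_ddagger y) < \<eta>"
      using assms(11) \<eta> unfolding uniformly_continuous_on_def by (metis UNIV_I dist_commute)
    have "u x - v x \<le> H + N * \<eta>"
      unfolding N_def
      by (rule comparison_estimate[OF assms(6,7,12,13) cont _ \<delta>(1) \<eta> H C'_def])
        (use \<delta>(2) in \<open>force simp: dist_real_def intro: less_imp_le\<close>)
    then show "u x - v x \<le> H + \<epsilon>" using N by (simp add: \<eta>_def)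
  qed
  then show ?thesis unfolding H_def[symmetric] by (intro cSUP_least) auto
qed

end
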